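(* Let $M$ be an m-cov random measure over $\mathbb{R}^d$ regulated by a function $f$. Then there exist a sequence $(X_n)_{n\in\mathbb{N}}$ of pairwise uncorrelated real random variables with summable variances $\sigma_{X_n}^2:=\mathrm{Var}(X_n)$, $\sum_n\sigma_{X_n}^2<\infty$, and a linearly independent sequence $(\mu_n)_{n\in\mathbb{N}}$ of real measures over $\mathbb{R}^d$, all of them regulated by $f$, such that, for every bounded Borel measurable function $\varphi:\mathbb{R}^d\to\mathbb{R}$ with compact support, $$\langle M,\varphi\rangle=\sum_{n\in\mathbb{N}}X_n\,\langle\mu_n,\varphi\rangle,$$ the series converging in mean-square. In addition, the covariance measure $C_M$ satisfies $$\Big|\,\langle C_M,\varphi\otimes\,\cdot\,\rangle-\sum_{j\le n}\sigma_{X_j}^2\langle\mu_j,\varphi\rangle\,\mu_j\Big|(K)\xrightarrow[n\to\infty]{}0$$ for every bounded Borel measurable $\varphi:\mathbb{R}^d\to\mathbb{R}$ with compact support and every compact $K\subset\mathbb{R}^d$. Here $\langle C_M,\varphi\otimes\,\cdot\,\rangle$ denotes the measure $B\mapsto\langle C_M,\varphi\otimes\mathbf{1}_B\rangle$ over $\mathbb{R}^d$, and $|\cdot|(K)$ is total variation on $K$.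
   Context: All random variables are real and defined on a common probability space $(\Omega,\mathcal{A},\mathbb{P})$. $\mathcal{B}_B(\mathbb{R}^d)$ denotes the $\delta$-ring of bounded Borel sets. A measure over $\mathbb{R}^d$ is a real-valued (signed) $\sigma$-additive function $\mu:\mathcal{B}_B(\mathbb{R}^d)\to\mathbb{R}$ (hence locally finite, possibly not defined on unbounded sets); $|\mu|$ is its total variation measure, the smallest positive measure with $|\mu(A)|\le|\mu|(A)$ for all $A\in\mathcal{B}_B(\mathbb{R}^d)$. $\mu$ is finite if $|\mu|(\mathbb{R}^d)<\infty$. $\langle\mu,\varphi\rangle=\int_{\mathbb{R}^d}\varphi\,d\mu$. A (centred measure-covariance second-order) random measure, called m-cov random measure, over $\mathbb{R}^d$ is a zero-mean stochastic process $M=(M(A))_{A\in\mathcal{B}_B(\mathbb{R}^d)}$ for which there is a measure $C_M$ over $\mathbb{R}^d\times\mathbb{R}^d$ (the covariance measure) with $\mathbb{E}(M(A)M(B))=C_M(A\times B)$ for all $A,B\in\mathcal{B}_B(\mathbb{R}^d)$. $M$ is finite if $C_M$ is finite. Let $f:\mathbb{R}^d\to(0,\infty)$ be a strictly positive, locally bounded, measurable function. A measure $\mu$ is regulated by $f$ if $\mu/f$ is a finite measure, i.e. $\int\frac1f\,d|\mu|<\infty$. An m-cov random measure $M$ is regulated by $f$ if $M/f$ (the random measure $A\mapsto\langle M,\mathbf{1}_A/f\rangle$) is a finite m-cov random measure; equivalently $C_M$ is regulated by $f\otimes f$, i.e. $\int\frac{1}{f(x)f(y)}\,d|C_M|(x,y)<\infty$.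 Write $(\varphi\otimes\phi)(x,y)=\varphi(x)\phi(y)$. For measurable $\varphi:\mathbb{R}^d\to\mathbb{R}$ with $\int|\varphi|\otimes|\varphi|\,d|C_M|<\infty$, $\langle M,\varphi\rangle=\int_{\mathbb{R}^d}\varphi(x)\,dM(x)\in L^2(\Omega,\mathcal{A},\mathbb{P})$ is the (Dunford–Schwartz) integral with respect to the $L^2(\Omega)$-valued measure $A\mapsto M(A)$: it is linear in $\varphi$, equals $M(A)$ for $\varphi=\mathbf{1}_A$, $A\in\mathcal{B}_B(\mathbb{R}^d)$, and is the $L^2(\Omega)$-limit of $\langle M,\varphi_n\rangle$ for any simple functions $\varphi_n$ (linear combinations of indicators of bounded Borel sets) with $\varphi_n\to\varphi$ pointwise and $|\varphi_n|\le|\varphi|$. One has $\mathbb{E}(\langle M,\varphi\rangle\langle M,\phi\rangle)=\langle C_M,\varphi\otimes\phi\rangle$. *)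

theory Defs
  imports "HOL-Probability.Probability"
begin

section \<open>Real measures on the bounded Borel sets\<close>

definition bdd_borel :: "'a::euclidean_space set set" where
  "bdd_borel = {A \<in> sets borel. bounded A}"

text \<open>A measure over the space is represented by a set function; only its values on
  \<^const>\<open>bdd_borel\<close> are meaningful, and no definition below looks at the others.\<close>

definition real_measure :: "('a::euclidean_space set \<Rightarrow> real) \<Rightarrow> bool" where
  "real_measure \<mu> \<longleftrightarrow>
     (\<forall>A::nat \<Rightarrow> 'a set. range A \<subseteq> bdd_borel \<longrightarrow> disjoint_family A \<longrightarrow> (\<Union>n. A n) \<in> bdd_borel \<longrightarrow>
        (\<lambda>n. \<mu> (A n)) sums \<mu> (\<Union>n. A n))"

text \<open>Among measures with the same measurable sets, the order on the type of measures is the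
  setwise one, so the following are the smallest positive Borel measures with the given bound.
  The second is the positive part of \<open>\<mu>\<close> in its Jordan decomposition; the function
  \<^const>\<open>ennreal\<close> sends negative numbers to \<open>0\<close>.\<close>

definition total_var :: "('a::euclidean_space set \<Rightarrow> real) \<Rightarrow> 'a measure" where
  "total_var \<mu> =
     (LEAST \<nu>. sets \<nu> = sets borel \<and> (\<forall>A\<in>bdd_borel. ennreal \<bar>\<mu> A\<bar> \<le> emeasure \<nu> A))"

definition pos_var :: "('a::euclidean_space set \<Rightarrow> real) \<Rightarrow> 'a measure" where
  "pos_var \<mu> =
     (LEAST \<nu>. sets \<nu> = sets borel \<and> (\<forall>A\<in>bdd_borel. ennreal (\<mu> A) \<le> emeasure \<nu> A))"

definition finite_real_measure :: "('a::euclidean_space set \<Rightarrow> real) \<Rightarrow> bool" where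
  "finite_real_measure \<mu> \<longleftrightarrow> emeasure (total_var \<mu>) UNIV < \<infinity>"

definition pairing :: "('a::euclidean_space set \<Rightarrow> real) \<Rightarrow> ('a \<Rightarrow> real) \<Rightarrow> real" where
  "pairing \<mu> \<phi> = (\<integral>x. \<phi> x \<partial>pos_var \<mu>) - (\<integral>x. \<phi> x \<partial>pos_var (\<lambda>A. - \<mu> A))"

definition tensor :: "('a \<Rightarrow> real) \<Rightarrow> ('a \<Rightarrow> real) \<Rightarrow> 'a \<times> 'a \<Rightarrow> real" where
  "tensor \<phi> \<psi> = (\<lambda>(x, y). \<phi> x * \<psi> y)"

definition locally_bounded :: "('a::topological_space \<Rightarrow> real) \<Rightarrow> bool" where
  "locally_bounded f \<longleftrightarrow> (\<forall>x. \<exists>U. open U \<and> x \<in> U \<and> bounded (f ` U))"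

definition regulated_measure ::
    "('a::euclidean_space \<Rightarrow> real) \<Rightarrow> ('a set \<Rightarrow> real) \<Rightarrow> bool" where
  "regulated_measure f \<mu> \<longleftrightarrow> (\<integral>\<^sup>+x. ennreal (1 / f x) \<partial>total_var \<mu>) < \<infinity>"

text \<open>Linear independence in the space of set functions on \<^const>\<open>bdd_borel\<close>; it forces the
  members of the sequence to be pairwise distinct.\<close>

definition lin_indep_measures :: "(nat \<Rightarrow> 'a::euclidean_space set \<Rightarrow> real) \<Rightarrow> bool" where
  "lin_indep_measures \<mu> \<longleftrightarrow>
     (\<forall>N. \<forall>c::nat \<Rightarrow> real. (\<forall>A\<in>bdd_borel. (\<Sum>i<N. c i * \<mu> i A) = 0) \<longrightarrow> (\<forall>i<N. c i = 0))"


section \<open>Square-integrable random variables\<close>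

definition square_integrable :: "'w measure \<Rightarrow> ('w \<Rightarrow> real) \<Rightarrow> bool" where
  "square_integrable P X \<longleftrightarrow> X \<in> borel_measurable P \<and> integrable P (\<lambda>\<omega>. (X \<omega>)\<^sup>2)"

definition L2_tendsto :: "'w measure \<Rightarrow> (nat \<Rightarrow> 'w \<Rightarrow> real) \<Rightarrow> ('w \<Rightarrow> real) \<Rightarrow> bool" where
  "L2_tendsto P Y X \<longleftrightarrow> (\<lambda>n. \<integral>\<^sup>+\<omega>. ennreal ((Y n \<omega> - X \<omega>)\<^sup>2) \<partial>P) \<longlonglongrightarrow> 0"

definition covariance :: "'w measure \<Rightarrow> ('w \<Rightarrow> real) \<Rightarrow> ('w \<Rightarrow> real) \<Rightarrow> real" where
  "covariance P X Y =
     (\<integral>\<omega>. (X \<omega> - (\<integral>\<omega>'. X \<omega>' \<partial>P)) * (Y \<omega> - (\<integral>\<omega>'. Y \<omega>' \<partial>P)) \<partial>P)"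


section \<open>Random measures\<close>

definition is_cov_measure ::
    "'w measure \<Rightarrow> ('a::euclidean_space set \<Rightarrow> 'w \<Rightarrow> real) \<Rightarrow> (('a \<times> 'a) set \<Rightarrow> real) \<Rightarrow> bool" where
  "is_cov_measure P M C \<longleftrightarrow> real_measure C \<and>
     (\<forall>A\<in>bdd_borel. \<forall>B\<in>bdd_borel. (\<integral>\<omega>. M A \<omega> * M B \<omega> \<partial>P) = C (A \<times> B))"

definition mcov_random_measure ::
    "'w measure \<Rightarrow> ('a::euclidean_space set \<Rightarrow> 'w \<Rightarrow> real) \<Rightarrow> bool" where
  "mcov_random_measure P M \<longleftrightarrow>
     (\<forall>A\<in>bdd_borel. square_integrable P (M A) \<and> (\<integral>\<omega>. M A \<omega> \<partial>P) = 0) \<and>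
     (\<exists>C. is_cov_measure P M C)"

text \<open>The values of the covariance measure on \<^const>\<open>bdd_borel\<close> are uniquely determined.\<close>

definition cov_measure ::
    "'w measure \<Rightarrow> ('a::euclidean_space set \<Rightarrow> 'w \<Rightarrow> real) \<Rightarrow> ('a \<times> 'a) set \<Rightarrow> real" where
  "cov_measure P M = (SOME C. is_cov_measure P M C)"

definition finite_random_measure ::
    "'w measure \<Rightarrow> ('a::euclidean_space set \<Rightarrow> 'w \<Rightarrow> real) \<Rightarrow> bool" where
  "finite_random_measure P M \<longleftrightarrow> finite_real_measure (cov_measure P M)"

text \<open>Linear combinations of indicators of bounded Borel sets, integrated by means of their
  canonical representation.\<close>

definition bdd_simple :: "('a::euclidean_space \<Rightarrow> real) \<Rightarrow> bool" where
  "bdd_simple s \<longleftrightarrow> simple_function borel s \<and> bounded {x. s x \<noteq> 0}"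

definition simple_rm_integral ::
    "('a set \<Rightarrow> 'w \<Rightarrow> real) \<Rightarrow> ('a \<Rightarrow> real) \<Rightarrow> 'w \<Rightarrow> real" where
  "simple_rm_integral M s = (\<lambda>\<omega>. \<Sum>c\<in>range s - {0}. c * M (s -` {c}) \<omega>)"

definition rm_integrable ::
    "'w measure \<Rightarrow> ('a::euclidean_space set \<Rightarrow> 'w \<Rightarrow> real) \<Rightarrow> ('a \<Rightarrow> real) \<Rightarrow> bool" where
  "rm_integrable P M \<phi> \<longleftrightarrow> \<phi> \<in> borel_measurable borel \<and>
     (\<integral>\<^sup>+z. ennreal (tensor (\<lambda>x. \<bar>\<phi> x\<bar>) (\<lambda>x. \<bar>\<phi> x\<bar>) z) \<partial>total_var (cov_measure P M)) < \<infinity>"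

text \<open>The integral is an element of \<open>L\<^sup>2\<close>, that is, a random variable up to almost sure equality;
  \<open>rm_integral P M \<phi>\<close> is a version of it. It is meaningful if \<^const>\<open>rm_integrable\<close> holds.\<close>

definition rm_integral ::
    "'w measure \<Rightarrow> ('a::euclidean_space set \<Rightarrow> 'w \<Rightarrow> real) \<Rightarrow> ('a \<Rightarrow> real) \<Rightarrow> 'w \<Rightarrow> real" where
  "rm_integral P M \<phi> = (SOME Y. square_integrable P Y \<and>
     (\<forall>s. (\<forall>n. bdd_simple (s n)) \<longrightarrow> (\<forall>x. (\<lambda>n. s n x) \<longlonglongrightarrow> \<phi> x) \<longrightarrow>
        (\<forall>n x. \<bar>s n x\<bar> \<le> \<bar>\<phi> x\<bar>) \<longrightarrow> L2_tendsto P (\<lambda>n. simple_rm_integral M (s n)) Y))"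

definition rm_divide ::
    "'w measure \<Rightarrow> ('a::euclidean_space set \<Rightarrow> 'w \<Rightarrow> real) \<Rightarrow> ('a \<Rightarrow> real) \<Rightarrow> 'a set \<Rightarrow> 'w \<Rightarrow> real" where
  "rm_divide P M f = (\<lambda>A. rm_integral P M (\<lambda>x. indicator A x / f x))"

definition regulated_random_measure ::
    "'w measure \<Rightarrow> ('a::euclidean_space \<Rightarrow> real) \<Rightarrow> ('a set \<Rightarrow> 'w \<Rightarrow> real) \<Rightarrow> bool" where
  "regulated_random_measure P f M \<longleftrightarrow>
     (\<forall>A\<in>bdd_borel. rm_integrable P M (\<lambda>x. indicator A x / f x)) \<and>
     mcov_random_measure P (rm_divide P M f) \<and> finite_random_measure P (rm_divide P M f)"

definition test_function :: "('a::euclidean_space \<Rightarrow> real) \<Rightarrow> bool" where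
  "test_function \<phi> \<longleftrightarrow> \<phi> \<in> borel_measurable borel \<and> bounded (range \<phi>) \<and>
     compact (closure {x. \<phi> x \<noteq> 0})"

end

theory Submission
  imports Defs
begin

text \<open>No spectral theory is needed: any orthonormal basis \<open>(e\<^sub>n)\<close> of the closed linear span of the
  variables \<open>M(A)\<close> in \<open>L\<^sup>2\<close> gives an expansion. The span is separable because a countable
  generator of the Borel sets is total in it, so the basis comes from Gram-Schmidt. Expanding
  \<open>\<langle>M, \<phi>\<rangle>\<close> along it gives \<open>X\<^sub>n = 2\<^sup>-\<^sup>n e\<^sub>n\<close> and \<open>\<mu>\<^sub>n(A) = 2\<^sup>n E(e\<^sub>n M(A))\<close>, where the powers of \<open>2\<close>
  only make the variances summable. For \<open>Z\<close> in \<open>L\<^sup>2\<close> the total variation of \<open>A \<mapsto> E(Z M(A))\<close> on \<open>K\<close> is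
  at most \<open>\<parallel>Z\<parallel> |C\<^sub>M|(K \<times> K)\<^sup>1\<^sup>/\<^sup>2\<close> by the Cauchy-Schwarz inequality. With \<open>Z\<close> the remainder of the series this is
  the convergence of the covariance measures, and the same estimate for \<open>M / f\<close> shows that every
  \<open>\<mu>\<^sub>n\<close> is regulated by \<open>f\<close>. Where Gram-Schmidt yields \<open>e\<^sub>n = 0\<close>, the term is replaced by \<open>X\<^sub>n = 0\<close> and
  the Dirac measure at a point that is an atom of none of the other \<open>\<mu>\<^sub>n\<close>, which keeps the
  measures linearly independent.\<close>

section \<open>Jordan decomposition on the bounded Borel sets\<close>

text \<open>\<open>total_var\<close> and \<open>pos_var\<close> are \<open>LEAST\<close> measures
  and \<open>rm_integral\<close> is a \<open>SOME\<close> value. Each becomes usable only once the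
  described object is shown to exist, hence the constructions of the Jordan parts and of L2 limits.
  A signed measure is given as a set function on bounded sets only, so even finite variation on a
  bounded set has to be proved.

  All L2 estimates rest on one identity: the squared norm of a finite combination of variables
  \<open>M (A i)\<close> is the integral of \<open>tensor u u\<close> against the covariance
  measure, \<open>u\<close> being the same combination of indicators. Almost sure additivity of
  \<open>M\<close>, the existence of the integral and the bound on \<open>M D - M E\<close> are
  instances. The variation on \<open>K\<close> is the supremum of \<open>\<mu> D - \<mu> E\<close>
  over disjoint bounded Borel \<open>D\<close> and \<open>E\<close> inside \<open>K\<close>, so a
  single Cauchy-Schwarz estimate bounds it and no partition is summed over.

  The Dirac points can be fixed before the measures are known: the second moment of
  \<open>M {x}\<close> is the mass of the covariance measure at \<open>(x, x)\<close>, which is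
  nonzero for countably many \<open>x\<close> only.\<close>

lemma bdd_borel_empty [simp]: "{} \<in> bdd_borel"
  and bdd_borel_Un: "A \<in> bdd_borel \<Longrightarrow> B \<in> bdd_borel \<Longrightarrow> A \<union> B \<in> bdd_borel"
  and bdd_borel_Diff: "A \<in> bdd_borel \<Longrightarrow> B \<in> sets borel \<Longrightarrow> A - B \<in> bdd_borel"
  and bdd_borel_Int: "A \<in> bdd_borel \<Longrightarrow> B \<in> sets borel \<Longrightarrow> A \<inter> B \<in> bdd_borel"
  and bdd_borel_sets: "A \<in> bdd_borel \<Longrightarrow> A \<in> sets borel"
  and bdd_borel_subset: "A \<in> bdd_borel \<Longrightarrow> B \<in> sets borel \<Longrightarrow> B \<subseteq> A \<Longrightarrow> B \<in> bdd_borel"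
  unfolding bdd_borel_def by (auto intro: bounded_subset)

lemma bdd_borel_Times:
  assumes "A \<in> bdd_borel" "B \<in> bdd_borel"
  shows "A \<times> B \<in> bdd_borel"
  using assms by (auto simp: bdd_borel_def bounded_Times borel_prod[symmetric])

lemma real_measure_sums:
  assumes "real_measure \<mu>" "\<And>n. A n \<in> bdd_borel" "disjoint_family A" "(\<Union>n. A n) \<in> bdd_borel"
  shows "(\<lambda>n. \<mu> (A n)) sums \<mu> (\<Union>n::nat. A n)"
  using assms unfolding real_measure_def by blast

lemma real_measure_empty:
  assumes "real_measure \<mu>"
  shows "\<mu> {} = 0"
proof -
  have "(\<lambda>n::nat. \<mu> {}) sums \<mu> (\<Union>n::nat. {})"
    by (rule real_measure_sums[OF assms]) (auto simp: disjoint_family_on_def)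
  then have "summable (\<lambda>n::nat. \<mu> {})"
    by (rule sums_summable)
  then show ?thesis
    by (simp add: summable_const_iff)
qed

lemma real_measure_Un:
  assumes "real_measure \<mu>" "A \<in> bdd_borel" "B \<in> bdd_borel" "A \<inter> B = {}"
  shows "\<mu> (A \<union> B) = \<mu> A + \<mu> B"
proof -
  have "(\<lambda>n. \<mu> (binaryset A B n)) sums \<mu> (\<Union>n. binaryset A B n)"
  proof (rule real_measure_sums[OF assms(1)])
    show "binaryset A B n \<in> bdd_borel" for n
      using assms by (auto simp: binaryset_def)
    show "disjoint_family (binaryset A B)"
      using assms by (auto simp: disjoint_family_on_def binaryset_def)
    show "(\<Union>n. binaryset A B n) \<in> bdd_borel"
      using assms by (simp add: UN_binaryset_eq bdd_borel_Un)
  qed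
  then show ?thesis
    using binaryset_sums[of \<mu> A B] real_measure_empty[OF assms(1)]
    by (simp add: UN_binaryset_eq sums_iff)
qed

lemma real_measure_Diff:
  assumes "real_measure \<mu>" "A \<in> bdd_borel" "B \<in> sets borel" "B \<subseteq> A"
  shows "\<mu> (A - B) = \<mu> A - \<mu> B"
proof -
  have "\<mu> ((A - B) \<union> B) = \<mu> (A - B) + \<mu> B"
    using assms by (intro real_measure_Un) (auto intro: bdd_borel_Diff bdd_borel_subset)
  moreover have "(A - B) \<union> B = A"
    using assms by auto
  ultimately show ?thesis
    by simp
qed

lemma real_measure_uminus: "real_measure \<mu> \<Longrightarrow> real_measure (\<lambda>A. - \<mu> A)"
  unfolding real_measure_def using sums_minus by blast

section \<open>Positive variation of a signed measure\<close>

text \<open>The classical formula for the positive part in the Jordan decomposition.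
  \<open>A\<close> may be unbounded, its competitors \<open>B\<close> are bounded. For a real
  measure the truncation at 0 by \<open>ennreal\<close> loses nothing, since the empty set is a
  competitor of value 0.\<close>

definition upper_var :: "('a::euclidean_space set \<Rightarrow> real) \<Rightarrow> 'a set \<Rightarrow> ennreal" where
  "upper_var \<mu> A = (SUP B\<in>{B \<in> bdd_borel. B \<subseteq> A}. ennreal (\<mu> B))"

lemma upper_var_upper:
  "B \<in> bdd_borel \<Longrightarrow> B \<subseteq> A \<Longrightarrow> ennreal (\<mu> B) \<le> upper_var \<mu> A"
  unfolding upper_var_def by (auto intro: SUP_upper)

lemma upper_var_mono: "A \<subseteq> B \<Longrightarrow> upper_var \<mu> A \<le> upper_var \<mu> B"
  unfolding upper_var_def by (rule SUP_subset_mono) auto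

text \<open>Competitors for disjoint sets unite to a competitor for the union, and their values add;
  a competitor of negative value counts as 0 and is dropped.\<close>

lemma upper_var_sum_le:
  assumes \<mu>: "real_measure \<mu>" and A: "\<And>i. i \<in> I \<Longrightarrow> A i \<in> sets borel"
    and d: "disjoint_family_on A I" and "finite I"
  shows "(\<Sum>i\<in>I. upper_var \<mu> (A i)) \<le> upper_var \<mu> (\<Union>i\<in>I. A i)"
  using \<open>finite I\<close> A d
proof (induction I rule: finite_induct)
  case (insert i I)
  define U where "U = (\<Union>i\<in>I. A i)"
  have U: "A i \<inter> U = {}"
    using insert unfolding U_def by (auto simp: disjoint_family_on_def)
  have one: "ennreal (\<mu> B) + ennreal (\<mu> B') \<le> upper_var \<mu> (A i \<union> U)"
    if B: "B \<in> bdd_borel" "B \<subseteq> A i" "B' \<in> bdd_borel" "B' \<subseteq> U" for B B'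
  proof -
    have eq: "\<mu> (B \<union> B') = \<mu> B + \<mu> B'"
      using that U by (intro real_measure_Un \<mu>) auto
    consider "\<mu> B < 0" | "\<mu> B' < 0" | "\<mu> B \<ge> 0" "\<mu> B' \<ge> 0"
      by linarith
    then show ?thesis
    proof cases
      case 1
      then show ?thesis
        using B by (simp add: ennreal_neg) (rule upper_var_upper, auto)
    next
      case 2
      then show ?thesis
        using B by (simp add: ennreal_neg) (rule upper_var_upper, auto)
    next
      case 3
      then have "ennreal (\<mu> B) + ennreal (\<mu> B') = ennreal (\<mu> (B \<union> B'))"
        by (simp add: eq)
      also have "\<dots> \<le> upper_var \<mu> (A i \<union> U)"
        using B by (intro upper_var_upper bdd_borel_Un) auto
      finally show ?thesis .
    qed
  qed
  have ne: "{B \<in> bdd_borel. B \<subseteq> A} \<noteq> {}" for A :: "'a set"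
    by (auto intro!: exI[of _ "{}"])
  have "ennreal (\<mu> B) + upper_var \<mu> U \<le> upper_var \<mu> (A i \<union> U)"
    if "B \<in> bdd_borel" "B \<subseteq> A i" for B
    unfolding upper_var_def[of \<mu> U] using one that
    by (subst ennreal_SUP_add_right[OF ne]) (auto intro: SUP_least)
  then have "upper_var \<mu> (A i) + upper_var \<mu> U \<le> upper_var \<mu> (A i \<union> U)"
    unfolding upper_var_def[of \<mu> "A i"]
    by (subst ennreal_SUP_add_left[OF ne, symmetric]) (auto intro: SUP_least)
  moreover have "(\<Sum>i\<in>I. upper_var \<mu> (A i)) \<le> upper_var \<mu> U"
    unfolding U_def using insert by (auto simp: disjoint_family_on_def)
  ultimately show ?case
    using insert by (simp add: U_def) (meson add_left_mono order_trans)
qed simp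

text \<open>One inequality is superadditivity of the partial sums. For the other, a competitor
  \<open>B\<close> is cut into the sets \<open>B \<inter> A i\<close>: their union is the bounded
  set \<open>B\<close>, so sigma-additivity of \<open>\<mu>\<close> applies even if the union of the
  \<open>A i\<close> is unbounded.\<close>

lemma upper_var_countably_additive:
  assumes \<mu>: "real_measure \<mu>"
  shows "countably_additive (sets borel) (upper_var \<mu>)"
proof (rule countably_additiveI)
  fix A :: "nat \<Rightarrow> 'a set"
  assume A: "range A \<subseteq> sets borel" and d: "disjoint_family A"
  show "(\<Sum>i. upper_var \<mu> (A i)) = upper_var \<mu> (\<Union>i. A i)"
  proof (rule antisym)
    show "(\<Sum>i. upper_var \<mu> (A i)) \<le> upper_var \<mu> (\<Union>i. A i)"
    proof (rule suminf_le_const)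
      fix n
      have "(\<Sum>i<n. upper_var \<mu> (A i)) \<le> upper_var \<mu> (\<Union>i<n. A i)"
        using A d by (intro upper_var_sum_le \<mu>) (auto simp: disjoint_family_on_def)
      also have "\<dots> \<le> upper_var \<mu> (\<Union>i. A i)"
        by (rule upper_var_mono) auto
      finally show "(\<Sum>i<n. upper_var \<mu> (A i)) \<le> upper_var \<mu> (\<Union>i. A i)" .
    qed simp
    show "upper_var \<mu> (\<Union>i. A i) \<le> (\<Sum>i. upper_var \<mu> (A i))"
      unfolding upper_var_def[of \<mu> "\<Union>i. A i"]
    proof (rule SUP_least)
      fix B assume "B \<in> {B \<in> bdd_borel. B \<subseteq> (\<Union>i. A i)}"
      then have B: "B \<in> bdd_borel" "B = (\<Union>i. B \<inter> A i)"
        by auto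
      have Bi: "B \<inter> A i \<in> bdd_borel" for i
        using A B by (auto intro: bdd_borel_Int)
      have "(\<lambda>i. \<mu> (B \<inter> A i)) sums \<mu> (\<Union>i. B \<inter> A i)"
        using B d Bi by (intro real_measure_sums \<mu>) (auto simp: disjoint_family_on_def)
      then have "(\<lambda>i. \<mu> (B \<inter> A i)) sums \<mu> B"
        using B by simp
      then have "(\<lambda>n. \<Sum>i<n. \<mu> (B \<inter> A i)) \<longlonglongrightarrow> \<mu> B"
        by (simp add: sums_def)
      then have "(\<lambda>n. ennreal (\<Sum>i<n. \<mu> (B \<inter> A i))) \<longlonglongrightarrow> ennreal (\<mu> B)"
        by (rule tendsto_ennrealI)
      moreover have "ennreal (\<Sum>i<n. \<mu> (B \<inter> A i)) \<le> (\<Sum>i. upper_var \<mu> (A i))" for n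
      proof -
        \<comment> \<open>The pieces may have values of both signs. Raising the negative ones to 0
          lets \<open>ennreal\<close> pass through the sum.\<close>
        have "ennreal (\<Sum>i<n. \<mu> (B \<inter> A i)) \<le> ennreal (\<Sum>i<n. max 0 (\<mu> (B \<inter> A i)))"
          by (intro ennreal_leI sum_mono) auto
        also have "\<dots> = (\<Sum>i<n. ennreal (\<mu> (B \<inter> A i)))"
          by (subst sum_ennreal[symmetric], simp, rule sum.cong) (auto simp: max_def ennreal_neg)
        also have "\<dots> \<le> (\<Sum>i<n. upper_var \<mu> (A i))"
          by (intro sum_mono upper_var_upper Bi) auto
        also have "\<dots> \<le> (\<Sum>i. upper_var \<mu> (A i))"
          by (rule sum_le_suminf) auto
        finally show ?thesis .
      qed
      ultimately show "ennreal (\<mu> B) \<le> (\<Sum>i. upper_var \<mu> (A i))"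
        by (meson LIMSEQ_le_const2)
    qed
  qed
qed

definition upper_measure :: "('a::euclidean_space set \<Rightarrow> real) \<Rightarrow> 'a measure" where
  "upper_measure \<mu> = measure_of UNIV (sets borel) (upper_var \<mu>)"

lemma sets_upper_measure [simp, measurable_cong]: "sets (upper_measure \<mu>) = sets borel"
  unfolding upper_measure_def using sets.sigma_sets_eq[of borel] by (simp add: space_borel)

lemma upper_var_empty: "real_measure \<mu> \<Longrightarrow> upper_var \<mu> {} = 0"
  unfolding upper_var_def by (subst SUP_cong[of _ "{{}}" _ "\<lambda>_. 0"]) (auto simp: real_measure_empty)

lemma emeasure_upper_measure:
  assumes "real_measure \<mu>" "A \<in> sets borel"
  shows "emeasure (upper_measure \<mu>) A = upper_var \<mu> A"
proof (rule emeasure_measure_of[OF upper_measure_def])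
  show "positive (sets (upper_measure \<mu>)) (upper_var \<mu>)"
    using assms by (simp add: positive_def upper_var_empty)
  show "countably_additive (sets (upper_measure \<mu>)) (upper_var \<mu>)"
    using upper_var_countably_additive assms by simp
qed (use assms in auto)

lemma upper_var_le_measure:
  assumes "sets \<nu> = sets borel" "\<And>A. A \<in> bdd_borel \<Longrightarrow> ennreal (\<mu> A) \<le> emeasure \<nu> A"
    "A \<in> sets borel"
  shows "upper_var \<mu> A \<le> emeasure \<nu> A"
  unfolding upper_var_def
proof (rule SUP_least)
  fix B assume "B \<in> {B \<in> bdd_borel. B \<subseteq> A}"
  then have "ennreal (\<mu> B) \<le> emeasure \<nu> B" "emeasure \<nu> B \<le> emeasure \<nu> A"
    using assms by (auto intro: emeasure_mono)
  then show "ennreal (\<mu> B) \<le> emeasure \<nu> A"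
    by (rule order_trans)
qed

text \<open>The \<open>LEAST\<close> is attained: \<open>A\<close> is a competitor for itself, and
  by monotonicity a measure that dominates \<open>\<mu>\<close> on bounded sets dominates the value
  of every competitor.\<close>

lemma pos_var_eq_upper_measure:
  assumes \<mu>: "real_measure \<mu>"
  shows "pos_var \<mu> = upper_measure \<mu>"
  unfolding pos_var_def
proof (rule Least_equality)
  show "sets (upper_measure \<mu>) = sets borel \<and>
    (\<forall>A\<in>bdd_borel. ennreal (\<mu> A) \<le> emeasure (upper_measure \<mu>) A)"
    by (auto simp: emeasure_upper_measure \<mu> bdd_borel_sets upper_var_upper)
next
  fix \<nu> :: "'a measure"
  assume "sets \<nu> = sets borel \<and> (\<forall>A\<in>bdd_borel. ennreal (\<mu> A) \<le> emeasure \<nu> A)"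
  then show "upper_measure \<mu> \<le> \<nu>"
    by (subst le_measure) (auto simp: emeasure_upper_measure \<mu> upper_var_le_measure)
qed

lemma sets_pos_var [simp, measurable_cong]: "real_measure \<mu> \<Longrightarrow> sets (pos_var \<mu>) = sets borel"
  by (simp add: pos_var_eq_upper_measure)

lemma space_pos_var [simp]: "real_measure \<mu> \<Longrightarrow> space (pos_var \<mu>) = UNIV"
  using sets_eq_imp_space_eq[OF sets_pos_var] by auto

lemma emeasure_pos_var:
  assumes "real_measure \<mu>" "A \<in> sets borel"
  shows "emeasure (pos_var \<mu>) A = upper_var \<mu> A"
  using assms by (simp add: pos_var_eq_upper_measure emeasure_upper_measure)

section \<open>Total variation as a supremum over disjoint pairs\<close>

lemma real_measure_diff_eq:
  assumes "real_measure \<mu>" "B1 \<in> bdd_borel" "B2 \<in> bdd_borel"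
  shows "\<mu> B1 - \<mu> B2 = \<mu> (B1 - B2) - \<mu> (B2 - B1)"
proof -
  have "\<mu> ((B1 - B2) \<union> (B1 \<inter> B2)) = \<mu> (B1 - B2) + \<mu> (B1 \<inter> B2)"
    "\<mu> ((B2 - B1) \<union> (B1 \<inter> B2)) = \<mu> (B2 - B1) + \<mu> (B1 \<inter> B2)"
    using assms by (intro real_measure_Un; auto intro: bdd_borel_Diff bdd_borel_Int bdd_borel_sets)+
  moreover have "(B1 - B2) \<union> (B1 \<inter> B2) = B1" "(B2 - B1) \<union> (B1 \<inter> B2) = B2"
    by auto
  ultimately show ?thesis
    by simp
qed

text \<open>Common points of two competitors cancel, and a competitor of the wrong sign can be
  replaced by the empty set, so disjoint pairs suffice.\<close>

lemma upper_var_add_least: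
  assumes \<mu>: "real_measure \<mu>"
    and le: "\<And>D E. D \<in> bdd_borel \<Longrightarrow> E \<in> bdd_borel \<Longrightarrow> D \<inter> E = {} \<Longrightarrow> D \<subseteq> A \<Longrightarrow> E \<subseteq> A \<Longrightarrow>
      ennreal (\<mu> D - \<mu> E) \<le> c"
  shows "upper_var \<mu> A + upper_var (\<lambda>A. - \<mu> A) A \<le> c"
proof -
  have one: "ennreal (\<mu> B1) + ennreal (- \<mu> B2) \<le> c"
    if B: "B1 \<in> bdd_borel" "B1 \<subseteq> A" "B2 \<in> bdd_borel" "B2 \<subseteq> A" for B1 B2
  proof -
    have gen: "ennreal (\<mu> D - \<mu> E) \<le> c"
      if D: "D \<in> bdd_borel" "E \<in> bdd_borel" "D \<subseteq> A" "E \<subseteq> A" for D E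
    proof -
      have "\<mu> D - \<mu> E = \<mu> (D - E) - \<mu> (E - D)"
        using D by (intro real_measure_diff_eq \<mu>) auto
      also have "ennreal \<dots> \<le> c"
        using D by (intro le) (auto intro: bdd_borel_Diff bdd_borel_sets)
      finally show ?thesis .
    qed
    consider "\<mu> B1 < 0" | "\<mu> B2 > 0" | "\<mu> B1 \<ge> 0" "\<mu> B2 \<le> 0"
      by linarith
    then show ?thesis
    proof cases
      case 1
      then show ?thesis
        using gen[of "{}" B2] B by (simp add: ennreal_neg real_measure_empty \<mu>)
    next
      case 2
      then show ?thesis
        using gen[of B1 "{}"] B by (simp add: ennreal_neg real_measure_empty \<mu>)
    next
      case 3
      then have "ennreal (\<mu> B1) + ennreal (- \<mu> B2) = ennreal (\<mu> B1 - \<mu> B2)"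
        by (subst ennreal_plus[symmetric]) auto
      then show ?thesis
        using gen[of B1 B2] B by simp
    qed
  qed
  have ne: "{B \<in> bdd_borel. B \<subseteq> A} \<noteq> {}"
    by (auto intro!: exI[of _ "{}"])
  have "ennreal (\<mu> D) + upper_var (\<lambda>A. - \<mu> A) A \<le> c" if "D \<in> bdd_borel" "D \<subseteq> A" for D
    unfolding upper_var_def using one that
    by (subst ennreal_SUP_add_right[OF ne]) (auto intro: SUP_least)
  then show ?thesis
    unfolding upper_var_def[of \<mu> A]
    by (subst ennreal_SUP_add_left[OF ne, symmetric]) (auto intro: SUP_least)
qed

definition var_measure :: "('a::euclidean_space set \<Rightarrow> real) \<Rightarrow> 'a measure" where
  "var_measure \<mu> =
     measure_of UNIV (sets borel) (\<lambda>A. upper_var \<mu> A + upper_var (\<lambda>A. - \<mu> A) A)"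

lemma sets_var_measure [simp, measurable_cong]: "sets (var_measure \<mu>) = sets borel"
  unfolding var_measure_def using sets.sigma_sets_eq[of borel] by (simp add: space_borel)

lemma emeasure_var_measure:
  assumes \<mu>: "real_measure \<mu>" and A: "A \<in> sets borel"
  shows "emeasure (var_measure \<mu>) A = upper_var \<mu> A + upper_var (\<lambda>A. - \<mu> A) A"
proof (rule emeasure_measure_of[OF var_measure_def])
  show "positive (sets (var_measure \<mu>)) (\<lambda>A. upper_var \<mu> A + upper_var (\<lambda>A. - \<mu> A) A)"
    using \<mu> by (simp add: positive_def upper_var_empty real_measure_uminus)
  show "countably_additive (sets (var_measure \<mu>)) (\<lambda>A. upper_var \<mu> A + upper_var (\<lambda>A. - \<mu> A) A)"
    using upper_var_countably_additive[OF \<mu>]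
      upper_var_countably_additive[OF real_measure_uminus[OF \<mu>]]
    by (simp add: countably_additive_def suminf_add[symmetric])
qed (use A in auto)

text \<open>Minimality comes from disjoint pairs inside \<open>A\<close>: a dominating
  \<open>\<nu>\<close> satisfies
  \<open>\<mu> D - \<mu> E \<le> \<nu> D + \<nu> E \<le> \<nu> A\<close>.\<close>

lemma total_var_eq_var_measure:
  assumes \<mu>: "real_measure \<mu>"
  shows "total_var \<mu> = var_measure \<mu>"
  unfolding total_var_def
proof (rule Least_equality)
  have "ennreal \<bar>\<mu> A\<bar> \<le> emeasure (var_measure \<mu>) A" if A: "A \<in> bdd_borel" for A
  proof -
    have "ennreal \<bar>\<mu> A\<bar> \<le> ennreal (\<mu> A) + ennreal (- \<mu> A)"
      by (cases "\<mu> A \<ge> 0") (auto simp: ennreal_neg)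
    also have "\<dots> \<le> upper_var \<mu> A + upper_var (\<lambda>A. - \<mu> A) A"
      using upper_var_upper[of A A \<mu>] upper_var_upper[of A A "\<lambda>A. - \<mu> A"] A
      by (intro add_mono) auto
    finally show ?thesis
      using A by (simp add: emeasure_var_measure \<mu> bdd_borel_sets)
  qed
  then show "sets (var_measure \<mu>) = sets borel \<and>
    (\<forall>A\<in>bdd_borel. ennreal \<bar>\<mu> A\<bar> \<le> emeasure (var_measure \<mu>) A)"
    by simp
next
  fix \<nu> :: "'a measure"
  assume "sets \<nu> = sets borel \<and> (\<forall>A\<in>bdd_borel. ennreal \<bar>\<mu> A\<bar> \<le> emeasure \<nu> A)"
  then have \<nu>: "sets \<nu> = sets borel" "\<And>A. A \<in> bdd_borel \<Longrightarrow> ennreal \<bar>\<mu> A\<bar> \<le> emeasure \<nu> A"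
    by auto
  have "upper_var \<mu> A + upper_var (\<lambda>A. - \<mu> A) A \<le> emeasure \<nu> A" if A: "A \<in> sets borel" for A
  proof (rule upper_var_add_least[OF \<mu>])
    fix D E assume D: "D \<in> bdd_borel" "E \<in> bdd_borel" "D \<inter> E = {}" "D \<subseteq> A" "E \<subseteq> A"
    have "ennreal (\<mu> D - \<mu> E) \<le> ennreal (\<bar>\<mu> D\<bar> + \<bar>\<mu> E\<bar>)"
      by (intro ennreal_leI) linarith
    also have "\<dots> = ennreal \<bar>\<mu> D\<bar> + ennreal \<bar>\<mu> E\<bar>"
      by simp
    also have "\<dots> \<le> emeasure \<nu> D + emeasure \<nu> E"
      using D by (intro add_mono \<nu>)
    also have "\<dots> = emeasure \<nu> (D \<union> E)"
      using D by (intro plus_emeasure) (auto simp: \<nu> bdd_borel_sets)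
    also have "\<dots> \<le> emeasure \<nu> A"
      using D A by (intro emeasure_mono) (auto simp: \<nu>)
    finally show "ennreal (\<mu> D - \<mu> E) \<le> emeasure \<nu> A" .
  qed
  then show "var_measure \<mu> \<le> \<nu>"
    using \<nu> by (subst le_measure) (auto simp: emeasure_var_measure \<mu>)
qed

lemma sets_total_var [simp, measurable_cong]: "real_measure \<mu> \<Longrightarrow> sets (total_var \<mu>) = sets borel"
  by (simp add: total_var_eq_var_measure)

lemma emeasure_total_var:
  assumes "real_measure \<mu>" "A \<in> sets borel"
  shows "emeasure (total_var \<mu>) A =
    emeasure (pos_var \<mu>) A + emeasure (pos_var (\<lambda>A. - \<mu> A)) A"
  using assms
  by (simp add: total_var_eq_var_measure emeasure_var_measure emeasure_pos_var real_measure_uminus)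

lemma emeasure_total_var_le:
  assumes \<mu>: "real_measure \<mu>" and "A \<in> sets borel"
    and le: "\<And>D E. D \<in> bdd_borel \<Longrightarrow> E \<in> bdd_borel \<Longrightarrow> D \<inter> E = {} \<Longrightarrow> D \<subseteq> A \<Longrightarrow> E \<subseteq> A \<Longrightarrow>
      ennreal (\<mu> D - \<mu> E) \<le> c"
  shows "emeasure (total_var \<mu>) A \<le> c"
proof -
  have "upper_var \<mu> A + upper_var (\<lambda>A. - \<mu> A) A \<le> c"
    by (rule upper_var_add_least[OF \<mu>]) (rule le)
  then show ?thesis
    using assms(1,2) by (simp add: total_var_eq_var_measure emeasure_var_measure)
qed

lemma total_var_cong:
  "(\<And>A. A \<in> bdd_borel \<Longrightarrow> \<mu> A = \<nu> A) \<Longrightarrow> total_var \<mu> = total_var \<nu>"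
  unfolding total_var_def by (metis (no_types, lifting))

text \<open>If the variation of a bounded set were infinite, the set could be split into a part of
  infinite variation and a part of measure at least \<open>1\<close> in absolute value; repeating this yields
  disjoint sets whose measures do not form a convergent series.\<close>

lemma total_var_finite:
  assumes \<mu>: "real_measure \<mu>" and "A \<in> bdd_borel"
  shows "emeasure (total_var \<mu>) A < \<infinity>"
proof (rule ccontr)
  assume inf: "\<not> emeasure (total_var \<mu>) A < \<infinity>"
  define Q where "Q A \<longleftrightarrow> A \<in> bdd_borel \<and> emeasure (total_var \<mu>) A = \<infinity>" for A
  have split: "\<exists>A'. Q A' \<and> A' \<subseteq> A \<and> 1 \<le> \<bar>\<mu> (A - A')\<bar>" if "Q A" for A
  proof -
    from that have A: "A \<in> bdd_borel" "emeasure (total_var \<mu>) A = \<infinity>"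
      by (auto simp: Q_def)
    \<comment> \<open>The margin \<open>1 + \<bar>\<mu> A\<bar>\<close> makes both \<open>E\<close>
      and \<open>A - E\<close> have measure at least 1 in absolute value. Whichever of them has
      infinite variation is kept, and the discarded one is large.\<close>
    have "\<exists>E. E \<in> bdd_borel \<and> E \<subseteq> A \<and> \<bar>\<mu> E\<bar> > 1 + \<bar>\<mu> A\<bar>"
    proof (rule ccontr)
      assume "\<not> ?thesis"
      then have le: "\<bar>\<mu> E\<bar> \<le> 1 + \<bar>\<mu> A\<bar>" if "E \<in> bdd_borel" "E \<subseteq> A" for E
        using that by (meson linorder_not_le)
      have "emeasure (total_var \<mu>) A \<le> ennreal (2 * (1 + \<bar>\<mu> A\<bar>))"
      proof (rule emeasure_total_var_le[OF \<mu> bdd_borel_sets[OF A(1)]])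
        fix D E assume "D \<in> bdd_borel" "E \<in> bdd_borel" "D \<subseteq> A" "E \<subseteq> A"
        then have "\<mu> D - \<mu> E \<le> 2 * (1 + \<bar>\<mu> A\<bar>)"
          using le[of D] le[of E] by (simp add: abs_le_iff)
        then show "ennreal (\<mu> D - \<mu> E) \<le> ennreal (2 * (1 + \<bar>\<mu> A\<bar>))"
          by (rule ennreal_leI)
      qed
      then show False
        using A(2) by (simp add: top_unique)
    qed
    then obtain E where E: "E \<in> bdd_borel" "E \<subseteq> A" "\<bar>\<mu> E\<bar> > 1 + \<bar>\<mu> A\<bar>"
      by auto
    have AE: "A - E \<in> bdd_borel"
      using A E by (auto intro: bdd_borel_Diff bdd_borel_sets)
    have d: "\<mu> (A - E) = \<mu> A - \<mu> E"
      using A E by (auto intro!: real_measure_Diff[OF \<mu>] bdd_borel_sets)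
    have "emeasure (total_var \<mu>) E + emeasure (total_var \<mu>) (A - E) = emeasure (total_var \<mu>) (E \<union> (A - E))"
      using E AE by (intro plus_emeasure) (auto simp: \<mu> bdd_borel_sets)
    also have "E \<union> (A - E) = A"
      using E by auto
    finally have "emeasure (total_var \<mu>) E = \<infinity> \<or> emeasure (total_var \<mu>) (A - E) = \<infinity>"
      using A by auto
    then show ?thesis
    proof
      assume "emeasure (total_var \<mu>) E = \<infinity>"
      then show ?thesis
        using E d by (intro exI[of _ E]) (auto simp: Q_def)
    next
      assume "emeasure (total_var \<mu>) (A - E) = \<infinity>"
      moreover have "A - (A - E) = E"
        using E by auto
      ultimately show ?thesis
        using E AE by (intro exI[of _ "A - E"]) (auto simp: Q_def)
    qed
  qed
  have "Q A"
    using inf assms by (simp add: Q_def less_top[symmetric])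
  then obtain S :: "nat \<Rightarrow> 'a set"
    where S: "\<And>n. Q (S n)" "\<And>n. S (Suc n) \<subseteq> S n \<and> 1 \<le> \<bar>\<mu> (S n - S (Suc n))\<bar>" "S 0 = A"
    using dependent_nat_choice[where P = "\<lambda>n A'. Q A' \<and> (n = 0 \<longrightarrow> A' = A)"
        and Q = "\<lambda>n A A'. A' \<subseteq> A \<and> 1 \<le> \<bar>\<mu> (A - A')\<bar>"] split
    by (metis old.nat.distinct(1))
  have Sb: "S n \<in> bdd_borel" for n
    using S by (auto simp: Q_def)
  have dec: "decseq S"
    using S by (intro decseq_SucI) auto
  \<comment> \<open>The union of the differences stays inside \<open>S 0\<close>, hence is bounded,
    so sigma-additivity is available.\<close>
  have "(\<lambda>n. \<mu> (S n - S (Suc n))) sums \<mu> (\<Union>n. S n - S (Suc n))"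
  proof (rule real_measure_sums[OF \<mu>])
    show D: "S n - S (Suc n) \<in> bdd_borel" for n
      by (intro bdd_borel_Diff Sb bdd_borel_sets)
    have "(S n - S (Suc n)) \<inter> (S m - S (Suc m)) = {}" if "n < m" for n m
      using decseqD[OF dec, of "Suc n" m] that by auto
    then show "disjoint_family (\<lambda>n. S n - S (Suc n))"
      unfolding disjoint_family_on_def by (metis Int_commute linorder_neqE_nat)
    show "(\<Union>n. S n - S (Suc n)) \<in> bdd_borel"
      using D by (intro bdd_borel_subset[OF Sb[of 0]])
        (auto intro: bdd_borel_sets decseqD[OF dec, THEN subsetD])
  qed
  then have "(\<lambda>n. \<mu> (S n - S (Suc n))) \<longlonglongrightarrow> 0"
    by (intro summable_LIMSEQ_zero) (rule sums_summable)
  then have "\<forall>\<^sub>F n in sequentially. \<bar>\<mu> (S n - S (Suc n))\<bar> < 1"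
    by (auto simp: tendsto_iff dist_real_def dest: spec[of _ 1])
  then show False
    using S(2) by (auto simp: eventually_sequentially) (meson linorder_not_le order_refl)
qed

lemma pos_var_finite:
  assumes "real_measure \<mu>" "A \<in> bdd_borel"
  shows "emeasure (pos_var \<mu>) A < \<infinity>"
  using total_var_finite[OF assms] assms
  by (auto simp: emeasure_total_var bdd_borel_sets)

text \<open>For \<open>D \<subseteq> A\<close>, \<open>\<mu> D = \<mu> A - \<mu> (A - D)\<close> is
  at most \<open>\<mu> A\<close> plus the negative part of \<open>A\<close>. The supremum over
  \<open>D\<close> gives one inequality, the same for \<open>- \<mu>\<close> the other.\<close>

lemma real_measure_eq_pos_var_diff:
  assumes \<mu>: "real_measure \<mu>" and A: "A \<in> bdd_borel"
  shows "\<mu> A = measure (pos_var \<mu>) A - measure (pos_var (\<lambda>A. - \<mu> A)) A"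
proof -
  have le: "measure (pos_var \<mu>) A \<le> \<mu> A + measure (pos_var (\<lambda>A. - \<mu> A)) A"
    if \<mu>: "real_measure \<mu>" for \<mu>
  proof -
    have m: "real_measure (\<lambda>A. - \<mu> A)"
      by (rule real_measure_uminus[OF \<mu>])
    have fin: "emeasure (pos_var (\<lambda>A. - \<mu> A)) A = ennreal (measure (pos_var (\<lambda>A. - \<mu> A)) A)"
      using pos_var_finite[OF m A] by (intro emeasure_eq_ennreal_measure) auto
    have B: "- \<mu> B \<le> measure (pos_var (\<lambda>A. - \<mu> A)) A" if "B \<in> bdd_borel" "B \<subseteq> A" for B
      using upper_var_upper[of B A "\<lambda>A. - \<mu> A"] that A fin
      by (simp add: emeasure_pos_var m bdd_borel_sets)
    have "emeasure (pos_var \<mu>) A \<le> ennreal (\<mu> A + measure (pos_var (\<lambda>A. - \<mu> A)) A)"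
      unfolding emeasure_pos_var[OF \<mu> bdd_borel_sets[OF A]] upper_var_def
    proof (intro SUP_least ennreal_leI)
      fix D assume "D \<in> {B \<in> bdd_borel. B \<subseteq> A}"
      then have D: "D \<in> bdd_borel" "D \<subseteq> A"
        by auto
      have "- \<mu> (A - D) \<le> measure (pos_var (\<lambda>A. - \<mu> A)) A"
        using D A by (intro B) (auto intro: bdd_borel_Diff bdd_borel_sets)
      moreover have "\<mu> (A - D) = \<mu> A - \<mu> D"
        using D A by (intro real_measure_Diff \<mu>) (auto intro: bdd_borel_sets)
      ultimately show "\<mu> D \<le> \<mu> A + measure (pos_var (\<lambda>A. - \<mu> A)) A"
        by simp
    qed
    moreover have "0 \<le> \<mu> A + measure (pos_var (\<lambda>A. - \<mu> A)) A"
      using B[of A] A by auto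
    ultimately show ?thesis
      by (simp add: measure_def enn2real_leI)
  qed
  show ?thesis
    using le[OF \<mu>] le[OF real_measure_uminus[OF \<mu>]] by simp
qed

section \<open>Integrals against a signed measure\<close>

lemma integrable_pos_var:
  fixes \<phi> :: "'a::euclidean_space \<Rightarrow> real"
  assumes \<mu>: "real_measure \<mu>" and [measurable]: "\<phi> \<in> borel_measurable borel" and K: "K \<in> bdd_borel"
    and le: "\<And>x. \<bar>\<phi> x\<bar> \<le> c * indicator K x"
  shows "integrable (pos_var \<mu>) \<phi>"
proof (rule Bochner_Integration.integrable_bound)
  show "integrable (pos_var \<mu>) (\<lambda>x. c * indicator K x :: real)"
    using pos_var_finite[OF \<mu> K] K \<mu> by (simp add: bdd_borel_sets)
  show "\<phi> \<in> borel_measurable (pos_var \<mu>)"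
    by (subst measurable_cong_sets[OF sets_pos_var[OF \<mu>] refl]) measurable
qed (use le in \<open>auto intro: order_trans[OF _ abs_ge_self]\<close>)

lemma pairing_sum_indicator:
  assumes \<mu>: "real_measure \<mu>" and "finite I" and A: "\<And>i. i \<in> I \<Longrightarrow> A i \<in> bdd_borel"
  shows "pairing \<mu> (\<lambda>x. \<Sum>i\<in>I. c i * indicator (A i) x) = (\<Sum>i\<in>I. c i * \<mu> (A i))"
proof -
  have int: "(\<integral>x. (\<Sum>i\<in>I. c i * indicator (A i) x) \<partial>pos_var \<nu>) = (\<Sum>i\<in>I. c i * measure (pos_var \<nu>) (A i))"
    if \<nu>: "real_measure \<nu>" for \<nu>
  proof -
    have "integrable (pos_var \<nu>) (\<lambda>x. c i * indicator (A i) x)" if "i \<in> I" for i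
      using A[OF that] bdd_borel_sets[OF A[OF that]]
      by (intro integrable_pos_var[OF \<nu>, of _ "A i" "\<bar>c i\<bar>"]) (auto simp: abs_mult)
    then show ?thesis
      by (simp add: Bochner_Integration.integral_sum \<nu>)
  qed
  show ?thesis
    unfolding pairing_def int[OF \<mu>] int[OF real_measure_uminus[OF \<mu>]]
    by (simp add: sum_subtractf[symmetric] right_diff_distrib[symmetric]
        real_measure_eq_pos_var_diff[OF \<mu> A, symmetric])
qed

lemma pairing_indicator:
  "real_measure \<mu> \<Longrightarrow> A \<in> bdd_borel \<Longrightarrow> pairing \<mu> (indicator A) = \<mu> A"
  using pairing_sum_indicator[of \<mu> "{()}" "\<lambda>_. A" "\<lambda>_. 1"] by simp

lemma pairing_LIMSEQ:
  assumes \<mu>: "real_measure \<mu>" and s: "\<And>n. s n \<in> borel_measurable borel" and K: "K \<in> bdd_borel"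
    and le: "\<And>n x. \<bar>s n x\<bar> \<le> c * indicator K x" and lim: "\<And>x. (\<lambda>n. s n x) \<longlonglongrightarrow> \<phi> x"
  shows "(\<lambda>n. pairing \<mu> (s n)) \<longlonglongrightarrow> pairing \<mu> \<phi>"
proof -
  have [measurable]: "\<phi> \<in> borel_measurable borel"
    by (rule borel_measurable_LIMSEQ_real[OF _ s]) (use lim in auto)
  have "(\<lambda>n. \<integral>x. s n x \<partial>pos_var \<nu>) \<longlonglongrightarrow> (\<integral>x. \<phi> x \<partial>pos_var \<nu>)" if \<nu>: "real_measure \<nu>" for \<nu>
  proof (rule integral_dominated_convergence)
    show "integrable (pos_var \<nu>) (\<lambda>x. c * indicator K x :: real)"
      using pos_var_finite[OF \<nu> K] K \<nu> by (simp add: bdd_borel_sets)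
    show "\<phi> \<in> borel_measurable (pos_var \<nu>)" "s n \<in> borel_measurable (pos_var \<nu>)" for n
      using s by (subst measurable_cong_sets[OF sets_pos_var[OF \<nu>] refl], measurable)+
  qed (use lim le in auto)
  then show ?thesis
    unfolding pairing_def using \<mu> real_measure_uminus[OF \<mu>] by (intro tendsto_diff) auto
qed

lemma abs_pairing_le:
  assumes \<mu>: "real_measure \<mu>" and \<phi>: "\<phi> \<in> borel_measurable borel" and K: "K \<in> bdd_borel"
    and le: "\<And>x. \<bar>\<phi> x\<bar> \<le> c * indicator K x"
  shows "\<bar>pairing \<mu> \<phi>\<bar> \<le> c * measure (total_var \<mu>) K"
proof -
  have m: "real_measure (\<lambda>A. - \<mu> A)"
    by (rule real_measure_uminus[OF \<mu>])
  have int: "\<bar>\<integral>x. \<phi> x \<partial>pos_var \<nu>\<bar> \<le> c * measure (pos_var \<nu>) K" if \<nu>: "real_measure \<nu>" for \<nu>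
  proof -
    have "\<bar>\<integral>x. \<phi> x \<partial>pos_var \<nu>\<bar> \<le> (\<integral>x. \<bar>\<phi> x\<bar> \<partial>pos_var \<nu>)"
      by (rule integral_abs_bound)
    also have "\<dots> \<le> (\<integral>x. c * indicator K x \<partial>pos_var \<nu>)"
      using pos_var_finite[OF \<nu> K] K
      by (intro integral_mono integrable_abs integrable_pos_var[OF \<nu> \<phi> K le] le)
        (simp add: bdd_borel_sets \<nu>)
    also have "\<dots> = c * measure (pos_var \<nu>) K"
      by (simp add: \<nu>)
    finally show ?thesis .
  qed
  have "measure (total_var \<mu>) K = measure (pos_var \<mu>) K + measure (pos_var (\<lambda>A. - \<mu> A)) K"
    using pos_var_finite[OF \<mu> K] pos_var_finite[OF m K] K
    by (simp add: measure_def emeasure_total_var[OF \<mu>] bdd_borel_sets enn2real_plus)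
  then show ?thesis
    using int[OF \<mu>] int[OF m] unfolding pairing_def by (simp add: algebra_simps)
qed

section \<open>Square-integrable random variables\<close>

text \<open>Elements of L2 are kept as functions, so almost sure equality appears as a difference of
  \<open>L2norm\<close> 0. The integral is 0 by default where it does not exist; therefore
  additivity carries square-integrability assumptions, while homogeneity does not.\<close>

definition ip :: "'w measure \<Rightarrow> ('w \<Rightarrow> real) \<Rightarrow> ('w \<Rightarrow> real) \<Rightarrow> real" where
  "ip P X Y = (\<integral>\<omega>. X \<omega> * Y \<omega> \<partial>P)"

definition L2norm :: "'w measure \<Rightarrow> ('w \<Rightarrow> real) \<Rightarrow> real" where
  "L2norm P X = sqrt (ip P X X)"

lemma square_integrable_measurable [measurable_dest]:
  "square_integrable P X \<Longrightarrow> X \<in> borel_measurable P"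
  by (simp add: square_integrable_def)

lemma square_integrable_mult:
  assumes "square_integrable P X" "square_integrable P Y"
  shows "integrable P (\<lambda>\<omega>. X \<omega> * Y \<omega>)"
proof (rule Bochner_Integration.integrable_bound)
  show "integrable P (\<lambda>\<omega>. (X \<omega>)\<^sup>2 + (Y \<omega>)\<^sup>2)"
    using assms by (simp add: square_integrable_def)
  have "\<bar>x * y\<bar> \<le> x\<^sup>2 + y\<^sup>2" for x y :: real
  proof -
    have "2 * \<bar>x * y\<bar> \<le> x\<^sup>2 + y\<^sup>2"
      using sum_squares_bound[of "\<bar>x\<bar>" "\<bar>y\<bar>"] by (simp add: abs_mult)
    then show ?thesis
      by (smt (verit) abs_ge_zero)
  qed
  then show "AE \<omega> in P. norm (X \<omega> * Y \<omega>) \<le> norm ((X \<omega>)\<^sup>2 + (Y \<omega>)\<^sup>2)"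
    by (auto intro: order_trans[OF _ abs_ge_self])
  show "(\<lambda>\<omega>. X \<omega> * Y \<omega>) \<in> borel_measurable P"
    using assms by measurable
qed

lemma square_integrable_zero [simp]: "square_integrable P (\<lambda>_. 0)"
  by (simp add: square_integrable_def)

lemma square_integrable_cmult:
  "square_integrable P X \<Longrightarrow> square_integrable P (\<lambda>\<omega>. c * X \<omega>)"
  by (auto simp: square_integrable_def power_mult_distrib)

lemma square_integrable_add:
  assumes "square_integrable P X" "square_integrable P Y"
  shows "square_integrable P (\<lambda>\<omega>. X \<omega> + Y \<omega>)"
  using assms square_integrable_mult[OF assms]
  by (auto simp: square_integrable_def power2_sum mult.assoc)

lemma square_integrable_diff:
  assumes "square_integrable P X" "square_integrable P Y"
  shows "square_integrable P (\<lambda>\<omega>. X \<omega> - Y \<omega>)"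
  using square_integrable_add[OF assms(1) square_integrable_cmult[OF assms(2), of "-1"]] by simp

lemma square_integrable_sum:
  "(\<And>i. i \<in> I \<Longrightarrow> square_integrable P (X i)) \<Longrightarrow> square_integrable P (\<lambda>\<omega>. \<Sum>i\<in>I. X i \<omega>)"
  by (induction I rule: infinite_finite_induct) (auto intro: square_integrable_add)

lemma ip_commute: "ip P X Y = ip P Y X"
  by (simp add: ip_def mult.commute)

lemma ip_nonneg: "0 \<le> ip P X X"
  by (simp add: ip_def)

lemma ip_zero_left [simp]: "ip P (\<lambda>_. 0) Y = 0"
  by (simp add: ip_def)

lemma ip_cmult_left: "ip P (\<lambda>\<omega>. c * X \<omega>) Y = c * ip P X Y"
  by (simp add: ip_def mult.assoc)

lemma ip_add_left:
  assumes "square_integrable P X" "square_integrable P X'" "square_integrable P Y"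
  shows "ip P (\<lambda>\<omega>. X \<omega> + X' \<omega>) Y = ip P X Y + ip P X' Y"
  using assms by (simp add: ip_def distrib_right square_integrable_mult)

lemma ip_diff_left:
  assumes "square_integrable P X" "square_integrable P X'" "square_integrable P Y"
  shows "ip P (\<lambda>\<omega>. X \<omega> - X' \<omega>) Y = ip P X Y - ip P X' Y"
  using assms by (simp add: ip_def left_diff_distrib square_integrable_mult)

lemma ip_sum_left:
  assumes "\<And>i. i \<in> I \<Longrightarrow> square_integrable P (X i)" "square_integrable P Y"
  shows "ip P (\<lambda>\<omega>. \<Sum>i\<in>I. X i \<omega>) Y = (\<Sum>i\<in>I. ip P (X i) Y)"
  using assms by (simp add: ip_def sum_distrib_right square_integrable_mult)

lemma ip_zero_right [simp]: "ip P X (\<lambda>_. 0) = 0"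
  by (simp add: ip_def)

lemma ip_cmult_right: "ip P X (\<lambda>\<omega>. c * Y \<omega>) = c * ip P X Y"
  using ip_cmult_left[of P c Y X] by (simp add: ip_commute)

lemma ip_add_right:
  assumes "square_integrable P X" "square_integrable P Y" "square_integrable P Y'"
  shows "ip P X (\<lambda>\<omega>. Y \<omega> + Y' \<omega>) = ip P X Y + ip P X Y'"
  using ip_add_left[OF assms(2,3,1)] by (simp add: ip_commute)

lemma ip_diff_right:
  assumes "square_integrable P X" "square_integrable P Y" "square_integrable P Y'"
  shows "ip P X (\<lambda>\<omega>. Y \<omega> - Y' \<omega>) = ip P X Y - ip P X Y'"
  using ip_diff_left[OF assms(2,3,1)] by (simp add: ip_commute)

lemma ip_sum_right:
  assumes "\<And>i. i \<in> I \<Longrightarrow> square_integrable P (X i)" "square_integrable P Y"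
  shows "ip P Y (\<lambda>\<omega>. \<Sum>i\<in>I. X i \<omega>) = (\<Sum>i\<in>I. ip P Y (X i))"
  using ip_sum_left[OF assms] by (simp add: ip_commute)

lemma L2norm_nonneg [simp]: "0 \<le> L2norm P X"
  by (simp add: L2norm_def ip_nonneg)

lemma L2norm_power2: "(L2norm P X)\<^sup>2 = ip P X X"
  by (simp add: L2norm_def ip_nonneg)

lemma L2norm_zero [simp]: "L2norm P (\<lambda>_. 0) = 0"
  by (simp add: L2norm_def)

lemma L2norm_cmult: "L2norm P (\<lambda>\<omega>. c * X \<omega>) = \<bar>c\<bar> * L2norm P X"
  by (simp add: L2norm_def ip_cmult_left ip_cmult_right real_sqrt_mult real_sqrt_abs2 mult.assoc[symmetric])

lemma ip_Cauchy_Schwarz: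
  assumes X: "square_integrable P X" and Y: "square_integrable P Y"
  shows "\<bar>ip P X Y\<bar> \<le> L2norm P X * L2norm P Y"
proof -
  have q: "0 \<le> ip P X X + 2 * t * ip P X Y + t\<^sup>2 * ip P Y Y" for t
  proof -
    have "ip P (\<lambda>\<omega>. X \<omega> + t * Y \<omega>) (\<lambda>\<omega>. X \<omega> + t * Y \<omega>) = ip P X X + 2 * t * ip P X Y + t\<^sup>2 * ip P Y Y"
      using X Y
      by (simp add: ip_add_left ip_add_right square_integrable_add square_integrable_cmult
          ip_cmult_left ip_cmult_right ip_commute[of P Y X] power2_eq_square algebra_simps)
    then show ?thesis
      using ip_nonneg[of P "\<lambda>\<omega>. X \<omega> + t * Y \<omega>"] by simp
  qed
  have "(ip P X Y)\<^sup>2 \<le> ip P X X * ip P Y Y"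
  proof (cases "ip P Y Y = 0")
    case True
    have "ip P X Y = 0"
    proof (rule ccontr)
      assume "ip P X Y \<noteq> 0"
      then show False
        \<comment> \<open>For \<open>ip P Y Y = 0\<close> the quadratic is affine in
          \<open>t\<close>, and this \<open>t\<close> gives it the value -1.\<close>
        using q[of "- (ip P X X + 1) / (2 * ip P X Y)"] True by (simp add: field_simps)
    qed
    then show ?thesis
      by (simp add: True)
  next
    case False
    then have "0 < ip P Y Y"
      using ip_nonneg[of P Y] by simp
    then show ?thesis
      \<comment> \<open>The minimum point of the quadratic.\<close>
      using q[of "- ip P X Y / ip P Y Y"] by (simp add: field_simps power2_eq_square)
  qed
  then have "sqrt ((ip P X Y)\<^sup>2) \<le> sqrt (ip P X X * ip P Y Y)"
    by (rule real_sqrt_le_mono)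
  then show ?thesis
    by (simp add: L2norm_def real_sqrt_mult)
qed

lemma L2norm_triangle:
  assumes X: "square_integrable P X" and Y: "square_integrable P Y"
  shows "L2norm P (\<lambda>\<omega>. X \<omega> + Y \<omega>) \<le> L2norm P X + L2norm P Y"
proof (rule power2_le_imp_le)
  have "(L2norm P (\<lambda>\<omega>. X \<omega> + Y \<omega>))\<^sup>2 = ip P X X + 2 * ip P X Y + ip P Y Y"
    using X Y by (simp add: L2norm_power2 ip_add_left ip_add_right square_integrable_add ip_commute[of P Y X])
  also have "\<dots> \<le> (L2norm P X + L2norm P Y)\<^sup>2"
    using ip_Cauchy_Schwarz[OF X Y] by (simp add: power2_sum L2norm_power2)
  finally show "(L2norm P (\<lambda>\<omega>. X \<omega> + Y \<omega>))\<^sup>2 \<le> (L2norm P X + L2norm P Y)\<^sup>2" .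
qed simp

lemma L2norm_minus_commute: "L2norm P (\<lambda>\<omega>. X \<omega> - Y \<omega>) = L2norm P (\<lambda>\<omega>. Y \<omega> - X \<omega>)"
  unfolding L2norm_def ip_def by (simp add: power2_eq_square[symmetric] power2_commute)

lemma L2norm_triangle_diff:
  assumes "square_integrable P X" "square_integrable P Y" "square_integrable P Z"
  shows "L2norm P (\<lambda>\<omega>. X \<omega> - Z \<omega>) \<le> L2norm P (\<lambda>\<omega>. X \<omega> - Y \<omega>) + L2norm P (\<lambda>\<omega>. Y \<omega> - Z \<omega>)"
  using L2norm_triangle[OF square_integrable_diff[OF assms(1,2)] square_integrable_diff[OF assms(2,3)]]
  by simp

lemma nn_integral_square:
  assumes "square_integrable P X"
  shows "(\<integral>\<^sup>+\<omega>. ennreal ((X \<omega>)\<^sup>2) \<partial>P) = ennreal ((L2norm P X)\<^sup>2)"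
  using assms unfolding L2norm_power2 ip_def
  by (subst nn_integral_eq_integral) (auto simp: square_integrable_def power2_eq_square)

lemma L2_tendsto_iff:
  assumes "\<And>n. square_integrable P (Y n)" "square_integrable P X"
  shows "L2_tendsto P Y X \<longleftrightarrow> (\<lambda>n. L2norm P (\<lambda>\<omega>. Y n \<omega> - X \<omega>)) \<longlonglongrightarrow> 0"
proof -
  have "L2_tendsto P Y X \<longleftrightarrow> (\<lambda>n. ennreal ((L2norm P (\<lambda>\<omega>. Y n \<omega> - X \<omega>))\<^sup>2)) \<longlonglongrightarrow> ennreal 0"
    unfolding L2_tendsto_def by (simp add: nn_integral_square square_integrable_diff assms)
  also have "\<dots> \<longleftrightarrow> (\<lambda>n. (L2norm P (\<lambda>\<omega>. Y n \<omega> - X \<omega>))\<^sup>2) \<longlonglongrightarrow> 0"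
    by (rule tendsto_ennreal_iff) auto
  also have "\<dots> \<longleftrightarrow> (\<lambda>n. L2norm P (\<lambda>\<omega>. Y n \<omega> - X \<omega>)) \<longlonglongrightarrow> 0"
    by (simp add: power_tendsto_0_iff)
  finally show ?thesis .
qed

lemma ip_LIMSEQ:
  assumes Y: "\<And>n. square_integrable P (Y n)" and X: "square_integrable P X"
    and lim: "(\<lambda>n. L2norm P (\<lambda>\<omega>. Y n \<omega> - X \<omega>)) \<longlonglongrightarrow> 0" and Z: "square_integrable P Z"
  shows "(\<lambda>n. ip P Z (Y n)) \<longlonglongrightarrow> ip P Z X"
proof -
  have "(\<lambda>n. ip P Z (Y n) - ip P Z X) \<longlonglongrightarrow> 0"
  proof (rule Lim_null_comparison[OF always_eventually[OF allI]])
    show "norm (ip P Z (Y n) - ip P Z X) \<le> L2norm P Z * L2norm P (\<lambda>\<omega>. Y n \<omega> - X \<omega>)" for n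
      using ip_Cauchy_Schwarz[OF Z square_integrable_diff[OF Y X]] by (simp add: ip_diff_right X Y Z)
    show "(\<lambda>n. L2norm P Z * L2norm P (\<lambda>\<omega>. Y n \<omega> - X \<omega>)) \<longlonglongrightarrow> 0"
      using tendsto_mult_left[OF lim] by simp
  qed
  then show ?thesis
    by (simp add: LIM_zero_iff)
qed

text \<open>Riesz-Fischer for increments of geometric size. On a probability space L1 norms are
  bounded by L2 norms, so the increments are almost surely absolutely summable and the sequence
  converges almost surely; Fatou's lemma turns this into convergence in L2.\<close>

lemma (in prob_space) L2_complete:
  assumes Z: "\<And>n. square_integrable M (Z n)"
    and le: "\<And>n. L2norm M (\<lambda>\<omega>. Z (Suc n) \<omega> - Z n \<omega>) \<le> c * (1/2) ^ n"
  obtains W where "square_integrable M W" "(\<lambda>n. L2norm M (\<lambda>\<omega>. Z n \<omega> - W \<omega>)) \<longlonglongrightarrow> 0"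
proof -
  define W where "W = (\<lambda>\<omega>. lim (\<lambda>n. Z n \<omega>))"
  have [measurable]: "Z n \<in> borel_measurable M" for n
    using Z by measurable
  have [measurable]: "W \<in> borel_measurable M"
    unfolding W_def by measurable
  have c: "0 \<le> c"
    using order_trans[OF L2norm_nonneg le[of 0]] by simp
  define D where "D n \<omega> = \<bar>Z (Suc n) \<omega> - Z n \<omega>\<bar>" for n \<omega>
  have [measurable]: "D n \<in> borel_measurable M" for n
    unfolding D_def by measurable
  have D: "(\<integral>\<^sup>+\<omega>. ennreal (D n \<omega>) \<partial>M) \<le> ennreal (c * (1/2) ^ n)" for n
  proof -
    have sq: "square_integrable M (D n)" "square_integrable M (\<lambda>_. 1)"
      using square_integrable_diff[OF Z Z, of "Suc n" n]
      by (auto simp: square_integrable_def D_def)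
    have "(\<integral>\<omega>. D n \<omega> \<partial>M) = ip M (D n) (\<lambda>_. 1)"
      by (simp add: ip_def)
    also have "\<dots> \<le> L2norm M (D n) * L2norm M (\<lambda>_. 1)"
      using ip_Cauchy_Schwarz[OF sq] by simp
    also have "\<dots> = L2norm M (\<lambda>\<omega>. Z (Suc n) \<omega> - Z n \<omega>)"
      by (simp add: L2norm_def ip_def D_def prob_space)
    finally show ?thesis
      using square_integrable_mult[OF sq] le[of n]
      by (subst nn_integral_eq_integral) (auto simp: D_def[abs_def] intro!: ennreal_leI)
  qed
  have "(\<integral>\<^sup>+\<omega>. (\<Sum>n. ennreal (D n \<omega>)) \<partial>M) = (\<Sum>n. \<integral>\<^sup>+\<omega>. ennreal (D n \<omega>) \<partial>M)"
    by (rule nn_integral_suminf) measurable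
  also have "\<dots> \<le> (\<Sum>n. ennreal (c * (1/2) ^ n))"
    by (rule suminf_le) (auto intro: D)
  also have "\<dots> = ennreal (\<Sum>n. c * (1/2) ^ n)"
    using c by (intro suminf_ennreal2 summable_mult summable_geometric) auto
  also have "\<dots> < \<infinity>"
    by simp
  finally have "AE \<omega> in M. (\<Sum>n. ennreal (D n \<omega>)) \<noteq> \<infinity>"
    by (intro nn_integral_noteq_infinite) auto
  then have conv: "AE \<omega> in M. (\<lambda>n. Z n \<omega>) \<longlonglongrightarrow> W \<omega>"
  proof eventually_elim
    case (elim \<omega>)
    have "summable (\<lambda>n. D n \<omega>)"
      using elim by (intro summable_suminf_not_top) (auto simp: D_def)
    then have "summable (\<lambda>n. Z (Suc n) \<omega> - Z n \<omega>)"
      unfolding D_def by (rule summable_rabs_cancel)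
    then have "convergent (\<lambda>n. \<Sum>i<n. Z (Suc i) \<omega> - Z i \<omega>)"
      by (simp add: summable_iff_convergent)
    then have "convergent (\<lambda>n. Z n \<omega> - Z 0 \<omega>)"
      by (simp add: sum_lessThan_telescope[of "\<lambda>i. Z i \<omega>"])
    then have "convergent (\<lambda>n. Z n \<omega> - Z 0 \<omega> + Z 0 \<omega>)"
      by (rule convergent_add[OF _ convergent_const])
    then show ?case
      unfolding W_def by (simp add: convergent_LIMSEQ_iff)
  qed
  \<comment> \<open>The subtracted tail makes the induction exact: the increment bound
    \<open>c * (1/2) ^ (n + k)\<close> equals the drop of \<open>2 * c * (1/2) ^ (n + k)\<close> at
    the next index.\<close>
  have dist: "L2norm M (\<lambda>\<omega>. Z n \<omega> - Z (n + k) \<omega>) \<le> 2 * c * (1/2) ^ n - 2 * c * (1/2) ^ (n + k)" for n k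
  proof (induction k)
    case (Suc k)
    then show ?case
      using L2norm_triangle_diff[OF Z Z Z, of n "n + Suc k" "n + k"] le[of "n + k"]
        L2norm_minus_commute[of M "Z (n + k)" "Z (n + Suc k)"]
      by simp
  qed simp
  have bound: "(\<integral>\<^sup>+\<omega>. ennreal ((Z n \<omega> - W \<omega>)\<^sup>2) \<partial>M) \<le> ennreal ((2 * c * (1/2) ^ n)\<^sup>2)" for n
  proof -
    have "(\<integral>\<^sup>+\<omega>. ennreal ((Z n \<omega> - W \<omega>)\<^sup>2) \<partial>M)
        = (\<integral>\<^sup>+\<omega>. liminf (\<lambda>k. ennreal ((Z n \<omega> - Z (n + k) \<omega>)\<^sup>2)) \<partial>M)"
    proof (rule nn_integral_cong_AE, use conv in eventually_elim)
      fix \<omega> assume "(\<lambda>n. Z n \<omega>) \<longlonglongrightarrow> W \<omega>"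
      then have "(\<lambda>k. Z (n + k) \<omega>) \<longlonglongrightarrow> W \<omega>"
        by (subst add.commute) (rule LIMSEQ_ignore_initial_segment)
      then have "(\<lambda>k. ennreal ((Z n \<omega> - Z (n + k) \<omega>)\<^sup>2)) \<longlonglongrightarrow> ennreal ((Z n \<omega> - W \<omega>)\<^sup>2)"
        by (intro tendsto_intros)
      then show "ennreal ((Z n \<omega> - W \<omega>)\<^sup>2) = liminf (\<lambda>k. ennreal ((Z n \<omega> - Z (n + k) \<omega>)\<^sup>2))"
        by (rule lim_imp_Liminf[OF sequentially_bot, symmetric])
    qed
    also have "\<dots> \<le> liminf (\<lambda>k. \<integral>\<^sup>+\<omega>. ennreal ((Z n \<omega> - Z (n + k) \<omega>)\<^sup>2) \<partial>M)"
      by (rule nn_integral_liminf) measurable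
    also have "\<dots> \<le> liminf (\<lambda>k::nat. ennreal ((2 * c * (1/2) ^ n)\<^sup>2))"
    proof (intro Liminf_mono always_eventually allI)
      fix k
      have "L2norm M (\<lambda>\<omega>. Z n \<omega> - Z (n + k) \<omega>) \<le> 2 * c * (1/2) ^ n"
        using dist[of n k] c by (smt (verit) mult_nonneg_nonneg zero_le_power half_gt_zero)
      then show "(\<integral>\<^sup>+\<omega>. ennreal ((Z n \<omega> - Z (n + k) \<omega>)\<^sup>2) \<partial>M) \<le> ennreal ((2 * c * (1/2) ^ n)\<^sup>2)"
        by (simp only: nn_integral_square[OF square_integrable_diff[OF Z Z]])
          (intro ennreal_leI power_mono, auto)
    qed
    finally show ?thesis
      by (simp add: Liminf_const)
  qed
  have sqd: "square_integrable M (\<lambda>\<omega>. Z n \<omega> - W \<omega>)" for n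
    unfolding square_integrable_def
    using bound[of n] by (auto intro!: integrableI_bounded simp: le_less_trans[OF _ ennreal_less_top])
  have sqW: "square_integrable M W"
    using square_integrable_diff[OF Z[of 0] sqd[of 0]] by simp
  have "L2norm M (\<lambda>\<omega>. Z n \<omega> - W \<omega>) \<le> 2 * c * (1/2) ^ n" for n
  proof (rule power2_le_imp_le)
    show "(L2norm M (\<lambda>\<omega>. Z n \<omega> - W \<omega>))\<^sup>2 \<le> (2 * c * (1/2) ^ n)\<^sup>2"
      using bound[of n] by (subst (asm) nn_integral_square[OF sqd]) (simp add: ennreal_le_iff)
  qed (use c in auto)
  then have le: "norm (L2norm M (\<lambda>\<omega>. Z n \<omega> - W \<omega>)) \<le> 2 * c * (1/2) ^ n" for n
    by simp
  have "(\<lambda>n. 2 * c * (1/2) ^ n) \<longlonglongrightarrow> 0"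
    by (intro tendsto_mult_right_zero LIMSEQ_power_zero) simp
  then have "(\<lambda>n. L2norm M (\<lambda>\<omega>. Z n \<omega> - W \<omega>)) \<longlonglongrightarrow> 0"
    by (rule Lim_null_comparison[OF always_eventually[OF allI[OF le]]])
  with sqW show ?thesis
    by (rule that)
qed

section \<open>Gram-Schmidt and orthonormal expansions\<close>

text \<open>Division by \<open>0\<close> makes a residual of norm \<open>0\<close> contribute the zero function, so no
  term of the sequence has to be skipped.\<close>

function gram_schmidt :: "'w measure \<Rightarrow> (nat \<Rightarrow> 'w \<Rightarrow> real) \<Rightarrow> nat \<Rightarrow> 'w \<Rightarrow> real" where
  "gram_schmidt P g k =
     (\<lambda>\<omega>. 1 / L2norm P (\<lambda>\<omega>. g k \<omega> - (\<Sum>j<k. ip P (g k) (gram_schmidt P g j) * gram_schmidt P g j \<omega>)) *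
       (g k \<omega> - (\<Sum>j<k. ip P (g k) (gram_schmidt P g j) * gram_schmidt P g j \<omega>)))"
  by auto
termination by (relation "Wellfounded.measure (\<lambda>(P, g, k). k)") auto

declare gram_schmidt.simps [simp del]

text \<open>Members may vanish, since the span may be finite-dimensional while the index runs
  through \<open>nat\<close>. A vanishing member is 0 everywhere, so the dichotomy is decided by an
  equation of functions.\<close>

locale orthonormal =
  fixes P :: "'w measure" and e :: "nat \<Rightarrow> 'w \<Rightarrow> real"
  assumes sq_e: "square_integrable P (e j)"
    and ortho: "i \<noteq> j \<Longrightarrow> ip P (e i) (e j) = 0"
    and normal: "ip P (e j) (e j) = 1 \<or> e j = (\<lambda>_. 0)"
begin

definition proj :: "nat \<Rightarrow> ('w \<Rightarrow> real) \<Rightarrow> 'w \<Rightarrow> real" where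
  "proj n Y = (\<lambda>\<omega>. \<Sum>j<n. ip P Y (e j) * e j \<omega>)"

text \<open>Membership in the closed span, encoded as convergence of the Fourier expansion of
  \<open>Y\<close> itself, which is the form the series in the theorem takes.\<close>

definition spanned :: "('w \<Rightarrow> real) \<Rightarrow> bool" where
  "spanned Y \<longleftrightarrow> square_integrable P Y \<and> (\<lambda>n. L2norm P (\<lambda>\<omega>. Y \<omega> - proj n Y \<omega>)) \<longlonglongrightarrow> 0"

lemma square_integrable_proj [simp]: "square_integrable P (proj n Y)"
  unfolding proj_def by (intro square_integrable_sum square_integrable_cmult sq_e)

lemma ip_proj_e:
  assumes "square_integrable P Y"
  shows "ip P (proj n Y) (e j) = (if j < n then ip P Y (e j) else 0)"
proof -
  have "ip P (proj n Y) (e j) = (\<Sum>i<n. ip P Y (e i) * ip P (e i) (e j))"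
    unfolding proj_def
    by (simp add: ip_sum_left square_integrable_cmult sq_e ip_cmult_left)
  also have "\<dots> = (\<Sum>i<n. if i = j then ip P Y (e j) * ip P (e j) (e j) else 0)"
    by (intro sum.cong) (auto simp: ortho)
  also have "\<dots> = (if j < n then ip P Y (e j) * ip P (e j) (e j) else 0)"
    by simp
  also have "ip P Y (e j) * ip P (e j) (e j) = ip P Y (e j)"
    using normal[of j] by auto
  finally show ?thesis .
qed

text \<open>\<open>proj n Y\<close> has the same inner product with itself as with \<open>Y\<close>,
  namely the sum of the squared coefficients. Expanding the square of the residual subtracts this
  once from \<open>ip P Y Y\<close>.\<close>

lemma L2norm_residual_le:
  assumes Y: "square_integrable P Y"
  shows "L2norm P (\<lambda>\<omega>. Y \<omega> - proj n Y \<omega>) \<le> L2norm P Y"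
proof -
  have *: "ip P Z (proj n Y) = (\<Sum>j<n. ip P Y (e j) * ip P Z (e j))" if "square_integrable P Z" for Z
    unfolding proj_def
    by (simp add: ip_sum_right square_integrable_cmult sq_e ip_cmult_right that)
  have "ip P (proj n Y) (proj n Y) = ip P Y (proj n Y)"
    by (simp add: * Y ip_proj_e)
  moreover have "0 \<le> ip P Y (proj n Y)"
    by (auto simp: * Y intro: sum_nonneg)
  ultimately have "ip P (\<lambda>\<omega>. Y \<omega> - proj n Y \<omega>) (\<lambda>\<omega>. Y \<omega> - proj n Y \<omega>) \<le> ip P Y Y"
    by (simp add: ip_diff_left ip_diff_right Y square_integrable_diff ip_commute[of P "proj n Y" Y])
  then show ?thesis
    by (simp add: L2norm_def)
qed

lemma proj_add:
  assumes "square_integrable P X" "square_integrable P Y"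
  shows "proj n (\<lambda>\<omega>. X \<omega> + Y \<omega>) = (\<lambda>\<omega>. proj n X \<omega> + proj n Y \<omega>)"
  unfolding proj_def by (simp add: ip_add_left assms sq_e distrib_right sum.distrib)

lemma proj_cmult: "proj n (\<lambda>\<omega>. c * X \<omega>) = (\<lambda>\<omega>. c * proj n X \<omega>)"
  unfolding proj_def by (simp add: ip_cmult_left sum_distrib_left mult.assoc)

lemma spanned_square_integrable: "spanned Y \<Longrightarrow> square_integrable P Y"
  by (simp add: spanned_def)

lemma spanned_zero: "spanned (\<lambda>_. 0)"
  by (simp add: spanned_def proj_def)

lemma spanned_cmult:
  assumes "spanned Y"
  shows "spanned (\<lambda>\<omega>. c * Y \<omega>)"
proof -
  have "L2norm P (\<lambda>\<omega>. c * Y \<omega> - proj n (\<lambda>\<omega>. c * Y \<omega>) \<omega>) = \<bar>c\<bar> * L2norm P (\<lambda>\<omega>. Y \<omega> - proj n Y \<omega>)" for n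
    using L2norm_cmult[of P c "\<lambda>\<omega>. Y \<omega> - proj n Y \<omega>"] by (simp add: proj_cmult right_diff_distrib)
  then show ?thesis
    using assms by (auto simp: spanned_def square_integrable_cmult intro: tendsto_mult_right_zero)
qed

lemma spanned_add:
  assumes X: "spanned X" and Y: "spanned Y"
  shows "spanned (\<lambda>\<omega>. X \<omega> + Y \<omega>)"
proof -
  note sq = spanned_square_integrable[OF X] spanned_square_integrable[OF Y]
  have le: "L2norm P (\<lambda>\<omega>. X \<omega> + Y \<omega> - proj n (\<lambda>\<omega>. X \<omega> + Y \<omega>) \<omega>)
      \<le> L2norm P (\<lambda>\<omega>. X \<omega> - proj n X \<omega>) + L2norm P (\<lambda>\<omega>. Y \<omega> - proj n Y \<omega>)" for n
    using L2norm_triangle[OF square_integrable_diff[OF sq(1) square_integrable_proj[of n X]]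
        square_integrable_diff[OF sq(2) square_integrable_proj[of n Y]]]
    by (simp add: proj_add sq algebra_simps)
  have "(\<lambda>n. L2norm P (\<lambda>\<omega>. X \<omega> - proj n X \<omega>) + L2norm P (\<lambda>\<omega>. Y \<omega> - proj n Y \<omega>)) \<longlonglongrightarrow> 0"
    using tendsto_add[of _ 0 _ _ 0] X Y by (auto simp: spanned_def)
  then have "(\<lambda>n. L2norm P (\<lambda>\<omega>. X \<omega> + Y \<omega> - proj n (\<lambda>\<omega>. X \<omega> + Y \<omega>) \<omega>)) \<longlonglongrightarrow> 0"
    by (rule Lim_null_comparison[OF always_eventually[OF allI], rotated]) (use le in auto)
  then show ?thesis
    using sq by (simp add: spanned_def square_integrable_add)
qed

lemma spanned_sum:
  "(\<And>i. i \<in> I \<Longrightarrow> spanned (X i)) \<Longrightarrow> spanned (\<lambda>\<omega>. \<Sum>i\<in>I. X i \<omega>)"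
  by (induction I rule: infinite_finite_induct) (auto intro: spanned_add spanned_zero)

text \<open>The residual map is linear and does not increase norms, so the residual norms of
  \<open>Y\<close> and \<open>X m\<close> differ by at most the distance of the two, uniformly in
  \<open>n\<close>.\<close>

lemma spanned_limit:
  assumes X: "\<And>m. spanned (X m)" and Y: "square_integrable P Y"
    and lim: "(\<lambda>m. L2norm P (\<lambda>\<omega>. X m \<omega> - Y \<omega>)) \<longlonglongrightarrow> 0"
  shows "spanned Y"
  unfolding spanned_def
proof (intro conjI Y LIMSEQ_I)
  fix r :: real assume "0 < r"
  note sq = spanned_square_integrable[OF X]
  from LIMSEQ_D[OF lim, of "r/2"] obtain m where m: "L2norm P (\<lambda>\<omega>. X m \<omega> - Y \<omega>) < r/2"
    using \<open>0 < r\<close> by auto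
  have "(\<lambda>n. L2norm P (\<lambda>\<omega>. X m \<omega> - proj n (X m) \<omega>)) \<longlonglongrightarrow> 0"
    using X by (simp add: spanned_def)
  from LIMSEQ_D[OF this, of "r/2"] obtain n0
    where n0: "\<And>n. n \<ge> n0 \<Longrightarrow> L2norm P (\<lambda>\<omega>. X m \<omega> - proj n (X m) \<omega>) < r/2"
    using \<open>0 < r\<close> by auto
  have "L2norm P (\<lambda>\<omega>. Y \<omega> - proj n Y \<omega>) < r" if "n \<ge> n0" for n
  proof -
    define D where "D = (\<lambda>\<omega>. Y \<omega> + (-1) * X m \<omega>)"
    have sqD: "square_integrable P D"
      unfolding D_def by (intro square_integrable_add square_integrable_cmult sq Y)
    have "L2norm P D < r/2"
      using m L2norm_minus_commute[of P "X m" Y] by (simp add: D_def)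
    moreover have "L2norm P (\<lambda>\<omega>. D \<omega> - proj n D \<omega>) \<le> L2norm P D"
      by (rule L2norm_residual_le[OF sqD])
    moreover have "proj n D = (\<lambda>\<omega>. proj n Y \<omega> + (-1) * proj n (X m) \<omega>)"
      unfolding D_def by (subst proj_add) (auto simp only: Y sq square_integrable_cmult proj_cmult)
    then have "L2norm P (\<lambda>\<omega>. Y \<omega> - proj n Y \<omega>)
        \<le> L2norm P (\<lambda>\<omega>. D \<omega> - proj n D \<omega>) + L2norm P (\<lambda>\<omega>. X m \<omega> - proj n (X m) \<omega>)"
      using L2norm_triangle[OF square_integrable_diff[OF sqD square_integrable_proj[of n D]]
          square_integrable_diff[OF sq[of m] square_integrable_proj[of n "X m"]]]
      by (simp add: D_def algebra_simps)
    ultimately show ?thesis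
      using n0[OF that] by simp
  qed
  then show "\<exists>no. \<forall>n\<ge>no. norm (L2norm P (\<lambda>\<omega>. Y \<omega> - proj n Y \<omega>) - 0) < r"
    by auto
qed

lemma spanned_cong:
  "spanned X \<Longrightarrow> square_integrable P Y \<Longrightarrow> L2norm P (\<lambda>\<omega>. X \<omega> - Y \<omega>) = 0 \<Longrightarrow> spanned Y"
  by (rule spanned_limit[of "\<lambda>_. X"]) auto

end

text \<open>\<open>g k\<close> is its residual plus a combination of earlier members, and the
  residual is a multiple of the new member up to norm 0, hence the input is spanned. The finite
  expansion in the input transfers to the members what is known of the input: zero mean, or
  orthogonality to a given variable.\<close>

lemma
  fixes g :: "nat \<Rightarrow> 'w \<Rightarrow> real"
  assumes g: "\<And>k. square_integrable P (g k)"
  shows orthonormal_gram_schmidt: "orthonormal P (gram_schmidt P g)"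
    and spanned_gram_schmidt: "orthonormal.spanned P (gram_schmidt P g) (g k)"
    and gram_schmidt_in_span: "\<And>k. \<exists>c. gram_schmidt P g k = (\<lambda>\<omega>. \<Sum>j\<le>k. c j * g j \<omega>)"
proof -
  define e where "e = gram_schmidt P g"
  define u where "u k = (\<lambda>\<omega>. g k \<omega> - (\<Sum>j<k. ip P (g k) (e j) * e j \<omega>))" for k
  have e: "e k = (\<lambda>\<omega>. 1 / L2norm P (u k) * u k \<omega>)" for k
    unfolding u_def e_def by (subst gram_schmidt.simps) (rule refl)
  have sq: "square_integrable P (u k) \<and> square_integrable P (e k)" for k
  proof (induction k rule: less_induct)
    case (less k)
    then have "square_integrable P (u k)"
      unfolding u_def
      by (intro square_integrable_diff square_integrable_sum square_integrable_cmult g) auto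
    then show ?case
      by (auto simp: e[of k] intro: square_integrable_cmult simp del: times_divide_eq_left)
  qed
  have normal: "ip P (e k) (e k) = 1 \<or> e k = (\<lambda>_. 0)" for k
  proof (cases "L2norm P (u k) = 0")
    case False
    then have "ip P (e k) (e k) = 1"
      unfolding e[of k] ip_cmult_left ip_cmult_right L2norm_power2[symmetric] power2_eq_square
      by simp
    then show ?thesis ..
  qed (simp add: e[of k])
  have ue: "ip P (u k) (e j) = 0" if "j < k" "\<And>i. i < k \<Longrightarrow> i \<noteq> j \<Longrightarrow> ip P (e i) (e j) = 0" for j k
  proof -
    have "ip P (u k) (e j) = ip P (g k) (e j) - (\<Sum>i<k. ip P (g k) (e i) * ip P (e i) (e j))"
      unfolding u_def using sq
      by (simp add: ip_diff_left g square_integrable_sum square_integrable_cmult ip_sum_left ip_cmult_left)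
    also have "(\<Sum>i<k. ip P (g k) (e i) * ip P (e i) (e j))
        = (\<Sum>i<k. if i = j then ip P (g k) (e j) * ip P (e j) (e j) else 0)"
      by (intro sum.cong) (auto simp: that)
    also have "\<dots> = ip P (g k) (e j) * ip P (e j) (e j)"
      using \<open>j < k\<close> by simp
    also have "\<dots> = ip P (g k) (e j)"
      using normal[of j] by auto
    finally show ?thesis
      by simp
  qed
  have o: "\<forall>j<k. ip P (e k) (e j) = 0" for k
  proof (induction k rule: less_induct)
    case (less k)
    show ?case
    proof (intro allI impI)
      fix j assume j: "j < k"
      have "ip P (u k) (e j) = 0"
        using less j by (intro ue) (metis ip_commute nat_neq_iff)+
      then show "ip P (e k) (e j) = 0"
        by (simp add: e[of k] ip_cmult_left del: times_divide_eq_left)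
    qed
  qed
  have ortho: "ip P (e i) (e j) = 0" if "i \<noteq> j" for i j
    using o that by (metis ip_commute nat_neq_iff)
  interpret orthonormal P e
    by standard (use sq ortho normal in auto)
  show "orthonormal P (gram_schmidt P g)"
    using orthonormal_axioms by (simp add: e_def)
  have "spanned (g k)"
  proof -
    have u: "u k = (\<lambda>\<omega>. g k \<omega> - proj k (g k) \<omega>)"
      by (simp add: u_def proj_def)
    \<comment> \<open>Equality holds in norm only: a residual of norm 0 need not vanish pointwise,
      whereas \<open>e k\<close> then does.\<close>
    have zero: "L2norm P (\<lambda>\<omega>. u k \<omega> - L2norm P (u k) * e k \<omega>) = 0"
    proof (cases "L2norm P (u k) = 0")
      case False
      then show ?thesis
        by (simp add: e[of k])
    qed simp
    have gk: "g k = (\<lambda>\<omega>. u k \<omega> + (\<Sum>j<k. ip P (g k) (e j) * e j \<omega>))"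
      by (simp add: u_def)
    have se: "spanned (e j)" for j
      unfolding spanned_def
    proof (intro conjI)
      have "proj n (e j) = e j" if "n > j" for n
      proof -
        have "proj n (e j) = (\<lambda>\<omega>. \<Sum>i<n. if i = j then ip P (e j) (e j) * e j \<omega> else 0)"
          unfolding proj_def by (intro ext sum.cong) (auto simp: ortho)
        then show ?thesis
          using that normal[of j] by auto
      qed
      then have "\<forall>\<^sub>F n in sequentially. L2norm P (\<lambda>\<omega>. e j \<omega> - proj n (e j) \<omega>) = 0"
        by (auto intro: eventually_mono[OF eventually_gt_at_top[of j]])
      then show "(\<lambda>n. L2norm P (\<lambda>\<omega>. e j \<omega> - proj n (e j) \<omega>)) \<longlonglongrightarrow> 0"
        by (rule tendsto_eventually)
    qed (use sq in auto)
    have "spanned (u k)"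
      using sq L2norm_minus_commute[of P] zero
      by (intro spanned_cong[OF spanned_cmult[OF se[of k], of "L2norm P (u k)"]]) auto
    then show ?thesis
      by (subst gk) (intro spanned_add spanned_sum spanned_cmult se)
  qed
  then show "orthonormal.spanned P (gram_schmidt P g) (g k)"
    by (simp add: e_def)
  show "\<exists>c. gram_schmidt P g k = (\<lambda>\<omega>. \<Sum>j\<le>k. c j * g j \<omega>)" for k
    unfolding e_def[symmetric]
  proof (induction k rule: less_induct)
    case (less k)
    then obtain c where c: "\<And>j. j < k \<Longrightarrow> e j = (\<lambda>\<omega>. \<Sum>i\<le>j. c j i * g i \<omega>)"
      by metis
    \<comment> \<open>The coefficient of \<open>g i\<close> after the expansions of the earlier
      \<open>e j\<close> are inserted; only those with \<open>i \<le> j\<close> contain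
      \<open>g i\<close>.\<close>
    define a where "a i = (\<Sum>j<k. if i \<le> j then ip P (g k) (e j) * c j i else 0)" for i
    have "(\<Sum>j<k. ip P (g k) (e j) * e j \<omega>) = (\<Sum>i<k. a i * g i \<omega>)" for \<omega>
    proof -
      have "(\<Sum>j<k. ip P (g k) (e j) * e j \<omega>)
          = (\<Sum>j<k. \<Sum>i<k. if i \<le> j then ip P (g k) (e j) * c j i * g i \<omega> else 0)"
      proof (intro sum.cong refl)
        fix j assume "j \<in> {..<k}"
        then have "{i \<in> {..<k}. i \<le> j} = {..j}"
          by auto
        then show "ip P (g k) (e j) * e j \<omega>
            = (\<Sum>i<k. if i \<le> j then ip P (g k) (e j) * c j i * g i \<omega> else 0)"
          using c[of j] \<open>j \<in> {..<k}\<close>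
          by (simp add: sum.inter_filter[symmetric] sum_distrib_left mult.assoc)
      qed
      also have "\<dots> = (\<Sum>i<k. \<Sum>j<k. if i \<le> j then ip P (g k) (e j) * c j i * g i \<omega> else 0)"
        by (rule sum.swap)
      also have "\<dots> = (\<Sum>i<k. a i * g i \<omega>)"
        unfolding a_def sum_distrib_right by (intro sum.cong) auto
      finally show ?thesis .
    qed
    then have "u k = (\<lambda>\<omega>. g k \<omega> - (\<Sum>i<k. a i * g i \<omega>))"
      by (simp add: u_def)
    then have "e k = (\<lambda>\<omega>. \<Sum>i\<le>k. (1 / L2norm P (u k) * (if i = k then 1 else - a i)) * g i \<omega>)"
      unfolding e[of k]
      by (auto simp: lessThan_Suc_atMost[symmetric] sum_distrib_left sum_subtractf sum_negf
          algebra_simps diff_divide_distrib sum_divide_distrib intro!: ext)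
    then show ?case
      by (rule exI[where x = "\<lambda>i. 1 / L2norm P (u k) * (if i = k then 1 else - a i)"])
  qed
qed

section \<open>Integration with respect to a random measure\<close>

lemma tensor_apply [simp]: "tensor \<phi> \<psi> (x, y) = \<phi> x * \<psi> y"
  by (simp add: tensor_def)

lemma tensor_measurable [measurable]:
  fixes \<phi> \<psi> :: "'a::euclidean_space \<Rightarrow> real"
  assumes [measurable]: "\<phi> \<in> borel_measurable borel" "\<psi> \<in> borel_measurable borel"
  shows "tensor \<phi> \<psi> \<in> borel_measurable borel"
  unfolding tensor_def borel_prod[symmetric] by measurable

lemma indicator_Times: "indicator (A \<times> B) (x, y) = (indicator A x * indicator B y :: real)"
  by (simp add: indicator_def)

lemma bdd_borel_ball [simp]: "ball 0 r \<in> bdd_borel"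
  by (simp add: bdd_borel_def)

lemma bdd_borel_subset_ball:
  assumes "A \<in> bdd_borel"
  obtains m :: nat where "A \<subseteq> ball 0 (real m)"
proof -
  obtain r where "\<And>x. x \<in> A \<Longrightarrow> norm x \<le> r"
    using assms unfolding bdd_borel_def bounded_iff by auto
  moreover obtain m :: nat where "r < real m"
    using reals_Archimedean2 by blast
  ultimately have "A \<subseteq> ball 0 (real m)"
    by (force simp: dist_norm)
  then show ?thesis
    by (rule that)
qed

section \<open>Isometry with integrals against the covariance measure\<close>

text \<open>The covariance measure is a parameter, so the locale serves both \<open>M\<close> and
  \<open>rm_divide P M f\<close>.\<close>

locale second_order_rm = prob_space P for P :: "'w measure" +
  fixes M :: "'a::euclidean_space set \<Rightarrow> 'w \<Rightarrow> real" and C :: "('a \<times> 'a) set \<Rightarrow> real"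
  assumes sq_M: "A \<in> bdd_borel \<Longrightarrow> square_integrable P (M A)"
    and real_measure_C: "real_measure C"
    and cov: "A \<in> bdd_borel \<Longrightarrow> B \<in> bdd_borel \<Longrightarrow> ip P (M A) (M B) = C (A \<times> B)"
begin

lemma square_integrable_combination:
  "(\<And>i. i \<in> I \<Longrightarrow> A i \<in> bdd_borel) \<Longrightarrow> square_integrable P (\<lambda>\<omega>. \<Sum>i\<in>I. c i * M (A i) \<omega>)"
  by (intro square_integrable_sum square_integrable_cmult sq_M)

text \<open>Bilinearity carries the covariance identity over from rectangles. The sets may overlap,
  and the right-hand side sees only the functions that they add up to; thus relations between
  indicators become relations between values of \<open>M\<close>.\<close>

lemma ip_combination:
  assumes I: "finite I" "\<And>i. i \<in> I \<Longrightarrow> A i \<in> bdd_borel"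
    and J: "finite J" "\<And>j. j \<in> J \<Longrightarrow> B j \<in> bdd_borel"
  shows "ip P (\<lambda>\<omega>. \<Sum>i\<in>I. c i * M (A i) \<omega>) (\<lambda>\<omega>. \<Sum>j\<in>J. d j * M (B j) \<omega>) =
    pairing C (tensor (\<lambda>x. \<Sum>i\<in>I. c i * indicator (A i) x) (\<lambda>x. \<Sum>j\<in>J. d j * indicator (B j) x))"
proof -
  have "ip P (\<lambda>\<omega>. \<Sum>i\<in>I. c i * M (A i) \<omega>) (\<lambda>\<omega>. \<Sum>j\<in>J. d j * M (B j) \<omega>)
      = (\<Sum>i\<in>I. \<Sum>j\<in>J. c i * d j * C (A i \<times> B j))"
  proof -
    have "ip P (M (A i)) (\<lambda>\<omega>. \<Sum>j\<in>J. d j * M (B j) \<omega>) = (\<Sum>j\<in>J. d j * C (A i \<times> B j))"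
      if "i \<in> I" for i
      using I J that
      by (simp add: ip_sum_right square_integrable_cmult sq_M ip_cmult_right cov)
    then show ?thesis
      using I J square_integrable_combination[of J B d]
      by (simp add: ip_sum_left square_integrable_cmult sq_M ip_cmult_left sum_distrib_left mult.assoc)
  qed
  also have "\<dots> = (\<Sum>(i, j)\<in>I \<times> J. c i * d j * C (A i \<times> B j))"
    by (rule sum.cartesian_product)
  also have "\<dots> = (\<Sum>p\<in>I \<times> J. (c (fst p) * d (snd p)) * C (A (fst p) \<times> B (snd p)))"
    by (simp add: case_prod_beta)
  also have "\<dots> = pairing C (\<lambda>z. \<Sum>p\<in>I \<times> J. (c (fst p) * d (snd p)) * indicator (A (fst p) \<times> B (snd p)) z)"
    using I J by (intro pairing_sum_indicator[symmetric] real_measure_C) (auto intro: bdd_borel_Times)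
  also have "(\<lambda>z. \<Sum>p\<in>I \<times> J. (c (fst p) * d (snd p)) * indicator (A (fst p) \<times> B (snd p)) z)
      = tensor (\<lambda>x. \<Sum>i\<in>I. c i * indicator (A i) x) (\<lambda>x. \<Sum>j\<in>J. d j * indicator (B j) x)"
    by (auto simp: fun_eq_iff indicator_Times sum_product sum.cartesian_product case_prod_beta
        mult_ac intro!: sum.cong)
  finally show ?thesis .
qed

lemma L2norm_combination_le:
  assumes I: "finite I" "\<And>i. i \<in> I \<Longrightarrow> A i \<in> bdd_borel" and K: "K \<in> bdd_borel"
    and le: "\<And>x. \<bar>\<Sum>i\<in>I. c i * indicator (A i) x\<bar> \<le> r * indicator K x"
  shows "(L2norm P (\<lambda>\<omega>. \<Sum>i\<in>I. c i * M (A i) \<omega>))\<^sup>2 \<le> r\<^sup>2 * measure (total_var C) (K \<times> K)"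
proof -
  let ?u = "\<lambda>x. \<Sum>i\<in>I. c i * indicator (A i) x"
  have [measurable]: "?u \<in> borel_measurable borel"
    using I by (intro borel_measurable_sum borel_measurable_times borel_measurable_indicator)
      (auto intro: bdd_borel_sets)
  have "\<bar>pairing C (tensor ?u ?u)\<bar> \<le> r\<^sup>2 * measure (total_var C) (K \<times> K)"
  proof (rule abs_pairing_le[OF real_measure_C _ bdd_borel_Times[OF K K]])
    fix z :: "'a \<times> 'a"
    obtain x y where z: "z = (x, y)"
      by fastforce
    have "\<bar>?u x\<bar> * \<bar>?u y\<bar> \<le> (r * indicator K x) * (r * indicator K y)"
      by (intro mult_mono le abs_ge_zero order_trans[OF abs_ge_zero le])
    then show "\<bar>tensor ?u ?u z\<bar> \<le> r\<^sup>2 * indicator (K \<times> K) z"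
      by (simp add: z indicator_Times abs_mult power2_eq_square algebra_simps)
  qed measurable
  then show ?thesis
    by (simp add: L2norm_power2 ip_combination[OF I I])
qed

text \<open>Pointwise convergence of \<open>u n\<close> to 0 gives that of
  \<open>tensor (u n) (u n)\<close>, and a common bound on \<open>K\<close> gives one on
  \<open>K \<times> K\<close>; dominated convergence does the rest.\<close>

lemma L2norm_combination_LIMSEQ:
  assumes I: "\<And>n. finite (I n)" "\<And>n i. i \<in> I n \<Longrightarrow> A n i \<in> bdd_borel" and K: "K \<in> bdd_borel"
    and le: "\<And>n x. \<bar>\<Sum>i\<in>I n. c n i * indicator (A n i) x\<bar> \<le> r * indicator K x"
    and lim: "\<And>x. (\<lambda>n. \<Sum>i\<in>I n. c n i * indicator (A n i) x) \<longlonglongrightarrow> 0"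
  shows "(\<lambda>n. L2norm P (\<lambda>\<omega>. \<Sum>i\<in>I n. c n i * M (A n i) \<omega>)) \<longlonglongrightarrow> 0"
proof -
  let ?u = "\<lambda>n x. \<Sum>i\<in>I n. c n i * indicator (A n i) x"
  have [measurable]: "?u n \<in> borel_measurable borel" for n
    using I by (intro borel_measurable_sum borel_measurable_times borel_measurable_indicator)
      (auto intro: bdd_borel_sets)
  have "(\<lambda>n. pairing C (tensor (?u n) (?u n))) \<longlonglongrightarrow> pairing C (\<lambda>_. 0)"
  proof (rule pairing_LIMSEQ[OF real_measure_C _ bdd_borel_Times[OF K K]])
    fix n and z :: "'a \<times> 'a"
    obtain x y where z: "z = (x, y)"
      by fastforce
    have "\<bar>?u n x\<bar> * \<bar>?u n y\<bar> \<le> (r * indicator K x) * (r * indicator K y)"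
      by (intro mult_mono le abs_ge_zero order_trans[OF abs_ge_zero le])
    then show "\<bar>tensor (?u n) (?u n) z\<bar> \<le> r\<^sup>2 * indicator (K \<times> K) z"
      by (simp add: z indicator_Times abs_mult power2_eq_square algebra_simps)
  next
    fix z :: "'a \<times> 'a"
    obtain x y where z: "z = (x, y)"
      by fastforce
    show "(\<lambda>n. tensor (?u n) (?u n) z) \<longlonglongrightarrow> 0"
      using tendsto_mult[OF lim[of x] lim[of y]] by (simp add: z)
  qed measurable
  then have "(\<lambda>n. (L2norm P (\<lambda>\<omega>. \<Sum>i\<in>I n. c n i * M (A n i) \<omega>))\<^sup>2) \<longlonglongrightarrow> 0"
    by (simp add: L2norm_power2 ip_combination I pairing_def)
  then show ?thesis
    by (simp add: power_tendsto_0_iff)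
qed

lemma L2norm_measure_diff_le:
  assumes "D \<in> bdd_borel" "E \<in> bdd_borel" "D \<inter> E = {}" "K \<in> bdd_borel" "D \<subseteq> K" "E \<subseteq> K"
  shows "L2norm P (\<lambda>\<omega>. M D \<omega> - M E \<omega>) \<le> sqrt (measure (total_var C) (K \<times> K))"
proof -
  \<comment> \<open>A combination indexed by \<open>bool\<close>. Disjointness keeps the modulus of
    \<open>indicator D - indicator E\<close> at most 1.\<close>
  have "(L2norm P (\<lambda>\<omega>. \<Sum>i\<in>UNIV. (if i then 1 else -1) * M (if i then D else E) \<omega>))\<^sup>2
      \<le> 1\<^sup>2 * measure (total_var C) (K \<times> K)"
  proof (rule L2norm_combination_le)
    fix x
    have "\<bar>indicator D x - indicator E x\<bar> \<le> (1 * indicator K x :: real)"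
      using assms by (auto simp: indicator_def)
    then show "\<bar>\<Sum>i\<in>UNIV. (if i then 1 else -1) * indicator (if i then D else E) x\<bar>
        \<le> (1 * indicator K x :: real)"
      by (simp add: UNIV_bool abs_minus_commute del: sum_mult_indicator sum_indicator_mult)
  qed (use assms in auto)
  then show ?thesis
    by (simp add: UNIV_bool real_le_rsqrt)
qed

text \<open>Additivity of \<open>M\<close> is an almost sure statement derived from the covariances:
  the matching combination of indicators is identically 0, so \<open>r = 0\<close> is an admissible
  bound.\<close>

lemma L2norm_additive:
  assumes "D \<in> bdd_borel" "E \<in> sets borel" "E \<subseteq> D"
  shows "L2norm P (\<lambda>\<omega>. M D \<omega> - M E \<omega> - M (D - E) \<omega>) = 0"
proof -
  have E: "E \<in> bdd_borel" "D - E \<in> bdd_borel"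
    using assms by (auto intro: bdd_borel_subset bdd_borel_Diff)
  define c :: "nat \<Rightarrow> real" where "c i = (if i = 0 then 1 else -1)" for i
  define A where "A i = (if i = 0 then D else if i = 1 then E else D - E)" for i :: nat
  have "(L2norm P (\<lambda>\<omega>. \<Sum>i<3. c i * M (A i) \<omega>))\<^sup>2 \<le> 0\<^sup>2 * measure (total_var C) (D \<times> D)"
    using assms E
    by (intro L2norm_combination_le)
      (auto simp: eval_nat_numeral c_def A_def indicator_def split: if_splits)
  then have "L2norm P (\<lambda>\<omega>. \<Sum>i<3. c i * M (A i) \<omega>) = 0"
    by simp
  then show ?thesis
    by (simp add: eval_nat_numeral c_def A_def)
qed

lemma L2norm_sigma_additive:
  assumes A: "\<And>n. A n \<in> bdd_borel" and d: "disjoint_family A" and U: "(\<Union>n. A n) \<in> bdd_borel"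
  shows "(\<lambda>n. L2norm P (\<lambda>\<omega>. (\<Sum>i<n. M (A i) \<omega>) - M (\<Union>n. A n) \<omega>)) \<longlonglongrightarrow> 0"
proof -
  \<comment> \<open>Indices below \<open>n\<close> carry the sets \<open>A i\<close> with
    coefficient 1; index \<open>n\<close> carries the whole union with coefficient -1.\<close>
  define c :: "nat \<Rightarrow> nat \<Rightarrow> real" where "c n i = (if i < n then 1 else -1)" for n i
  define B where "B n i = (if i < n then A i else (\<Union>n. A n))" for n i :: nat
  have s: "(\<Sum>i<Suc n. c n i * F (B n i)) = (\<Sum>i<n. F (A i)) - F (\<Union>n. A n)" for F :: "'a set \<Rightarrow> real" and n
    by (simp add: c_def B_def)
  have ind: "(\<Sum>i<n. indicator (A i) x) = (indicator (\<Union>i<n. A i) x :: real)" for n x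
    using d by (intro indicator_UN_disjoint[symmetric]) (auto simp: disjoint_family_on_def)
  have "(\<lambda>n. L2norm P (\<lambda>\<omega>. \<Sum>i<Suc n. c n i * M (B n i) \<omega>)) \<longlonglongrightarrow> 0"
  proof (rule L2norm_combination_LIMSEQ[OF _ _ U, where r = 1])
    show "B n i \<in> bdd_borel" for n i
      using A U by (simp add: B_def)
    show "\<bar>\<Sum>i<Suc n. c n i * indicator (B n i) x\<bar> \<le> 1 * indicator (\<Union>n. A n) x" for n x
      unfolding s[of _ "\<lambda>B. indicator B x"] ind by (auto simp: indicator_def)
    show "(\<lambda>n. \<Sum>i<Suc n. c n i * indicator (B n i) x) \<longlonglongrightarrow> 0" for x
      unfolding s[of _ "\<lambda>B. indicator B x"] ind
      using LIMSEQ_indicator_UN[of A x] LIM_zero by fastforce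
  qed simp
  moreover have "(\<lambda>\<omega>. \<Sum>i<Suc n. c n i * M (B n i) \<omega>) = (\<lambda>\<omega>. (\<Sum>i<n. M (A i) \<omega>) - M (\<Union>n. A n) \<omega>)" for n
    by (rule ext) (rule s[of _ "\<lambda>B. M B _"])
  ultimately show ?thesis
    by (simp only:)
qed

lemma real_measure_ip:
  assumes Z: "square_integrable P Z"
  shows "real_measure (\<lambda>A. ip P Z (M A))"
  unfolding real_measure_def
proof (intro allI impI)
  fix A :: "nat \<Rightarrow> 'a set"
  assume "range A \<subseteq> bdd_borel" "disjoint_family A" and U: "(\<Union>n. A n) \<in> bdd_borel"
  then have A: "A n \<in> bdd_borel" for n
    by auto
  have "(\<lambda>n. ip P Z (\<lambda>\<omega>. \<Sum>i<n. M (A i) \<omega>)) \<longlonglongrightarrow> ip P Z (M (\<Union>n. A n))"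
    using A \<open>disjoint_family A\<close> U
    by (intro ip_LIMSEQ L2norm_sigma_additive square_integrable_sum sq_M Z)
  then show "(\<lambda>n. ip P Z (M (A n))) sums ip P Z (M (\<Union>n. A n))"
    by (simp add: sums_def ip_sum_right sq_M A Z)
qed

text \<open>Kept apart from the variation bound because it is also applied, with
  \<open>M / f\<close> in place of \<open>M\<close>, to the two halves of a Hahn
  decomposition.\<close>

lemma ip_measure_diff_le:
  assumes Z: "square_integrable P Z"
    and "D \<in> bdd_borel" "E \<in> bdd_borel" "D \<inter> E = {}" "K \<in> bdd_borel" "D \<subseteq> K" "E \<subseteq> K"
  shows "ip P Z (M D) - ip P Z (M E) \<le> L2norm P Z * sqrt (measure (total_var C) (K \<times> K))"
proof -
  have "ip P Z (M D) - ip P Z (M E) = ip P Z (\<lambda>\<omega>. M D \<omega> - M E \<omega>)"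
    using assms by (simp add: ip_diff_right sq_M)
  also have "\<dots> \<le> L2norm P Z * L2norm P (\<lambda>\<omega>. M D \<omega> - M E \<omega>)"
    using ip_Cauchy_Schwarz[OF Z square_integrable_diff[OF sq_M sq_M]] assms by force
  also have "\<dots> \<le> L2norm P Z * sqrt (measure (total_var C) (K \<times> K))"
    using assms by (intro mult_left_mono L2norm_measure_diff_le) auto
  finally show ?thesis .
qed

lemma total_var_ip_le:
  assumes "square_integrable P Z" "K \<in> bdd_borel"
  shows "emeasure (total_var (\<lambda>A. ip P Z (M A))) K
    \<le> ennreal (L2norm P Z * sqrt (measure (total_var C) (K \<times> K)))"
  using assms ip_measure_diff_le
  by (intro emeasure_total_var_le real_measure_ip ennreal_leI) (auto simp: bdd_borel_sets)

end

section \<open>Test functions and simple approximation\<close>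

lemma test_functionD:
  assumes "test_function \<phi>"
  shows "\<phi> \<in> borel_measurable borel" "{x. \<phi> x \<noteq> 0} \<in> bdd_borel"
    "\<exists>b. \<forall>x. \<bar>\<phi> x\<bar> \<le> b * indicator {x. \<phi> x \<noteq> 0} x"
proof -
  show m [measurable]: "\<phi> \<in> borel_measurable borel"
    using assms by (simp add: test_function_def)
  have "bounded {x. \<phi> x \<noteq> 0}"
    using assms compact_imp_bounded bounded_subset closure_subset unfolding test_function_def by metis
  then show "{x. \<phi> x \<noteq> 0} \<in> bdd_borel"
    by (simp add: bdd_borel_def)
  obtain b where "\<And>x. \<bar>\<phi> x\<bar> \<le> b"
    using assms by (auto simp: test_function_def bounded_iff)
  then show "\<exists>b. \<forall>x. \<bar>\<phi> x\<bar> \<le> b * indicator {x. \<phi> x \<noteq> 0} x"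
    by (intro exI[of _ b]) (auto simp: indicator_def)
qed

lemma test_functionI:
  assumes "\<phi> \<in> borel_measurable borel" "K \<in> bdd_borel" "\<And>x. \<bar>\<phi> x\<bar> \<le> b * indicator K x"
  shows "test_function \<phi>"
  unfolding test_function_def
proof (intro conjI assms(1))
  have "\<bar>\<phi> x\<bar> \<le> \<bar>b\<bar>" for x
    using assms(3)[of x] by (cases "x \<in> K") auto
  then show "bounded (range \<phi>)"
    by (auto simp: bounded_iff)
  have "{x. \<phi> x \<noteq> 0} \<subseteq> K"
  proof
    fix x assume "x \<in> {x. \<phi> x \<noteq> 0}"
    then show "x \<in> K"
      using assms(3)[of x] by (cases "x \<in> K") auto
  qed
  then have "bounded {x. \<phi> x \<noteq> 0}"
    using assms(2) by (auto simp: bdd_borel_def intro: bounded_subset)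
  then show "compact (closure {x. \<phi> x \<noteq> 0})"
    by (simp add: compact_closure)
qed

text \<open>The modulus is rounded down to a multiple of \<open>(1/2) ^ n\<close> and the sign
  restored, so the approximation is dominated by \<open>\<phi>\<close> and vanishes where
  \<open>\<phi>\<close> does. The uniform geometric error provides the rate that
  \<open>L2_complete\<close> asks for.\<close>

lemma test_function_uniform_approx:
  fixes \<phi> :: "'a::euclidean_space \<Rightarrow> real"
  assumes \<phi>: "test_function \<phi>"
  obtains s where "\<And>n. bdd_simple (s n)" "\<And>n x. \<bar>s n x\<bar> \<le> \<bar>\<phi> x\<bar>"
    "\<And>n x. \<bar>s n x - \<phi> x\<bar> \<le> (1/2) ^ n * indicator {x. \<phi> x \<noteq> 0} x"
    "\<And>x. (\<lambda>n. s n x) \<longlonglongrightarrow> \<phi> x"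
proof -
  note [measurable] = test_functionD(1)[OF \<phi>]
  define s :: "nat \<Rightarrow> 'a \<Rightarrow> real" where "s n x = sgn (\<phi> x) * (of_int \<lfloor>2 ^ n * \<bar>\<phi> x\<bar>\<rfloor> / 2 ^ n)" for n x
  obtain b where b: "\<And>x. \<bar>\<phi> x\<bar> \<le> b"
    using \<phi> by (auto simp: test_function_def bounded_iff)
  have le: "real_of_int \<lfloor>2 ^ n * \<bar>\<phi> x\<bar>\<rfloor> / 2 ^ n \<le> \<bar>\<phi> x\<bar>" for n x
    by (simp add: divide_le_eq mult.commute)
  have ge: "\<bar>\<phi> x\<bar> - (1/2) ^ n \<le> real_of_int \<lfloor>2 ^ n * \<bar>\<phi> x\<bar>\<rfloor> / 2 ^ n" for n x
  proof -
    have "2 ^ n * \<bar>\<phi> x\<bar> - 1 \<le> real_of_int \<lfloor>2 ^ n * \<bar>\<phi> x\<bar>\<rfloor>"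
      by linarith
    then have "(2 ^ n * \<bar>\<phi> x\<bar> - 1) / 2 ^ n \<le> real_of_int \<lfloor>2 ^ n * \<bar>\<phi> x\<bar>\<rfloor> / 2 ^ n"
      by (rule divide_right_mono) simp
    then show ?thesis
      by (simp add: diff_divide_distrib power_one_over)
  qed
  show ?thesis
  proof (rule that[of s])
    fix n
    have "finite (range (s n))"
    proof (rule finite_subset)
      show "range (s n) \<subseteq> (\<lambda>(a, k). a * (real_of_int k / 2 ^ n)) ` ({-1, 0, 1} \<times> {0..\<lfloor>2 ^ n * b\<rfloor>})"
      proof (intro image_subsetI)
        fix x
        have "\<lfloor>2 ^ n * \<bar>\<phi> x\<bar>\<rfloor> \<in> {0..\<lfloor>2 ^ n * b\<rfloor>}"
          using b[of x] by (auto intro: floor_mono)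
        moreover have "sgn (\<phi> x) \<in> {-1, 0, 1}"
          by (auto simp: sgn_if)
        ultimately show "s n x \<in> (\<lambda>(a, k). a * (real_of_int k / 2 ^ n)) ` ({-1, 0, 1} \<times> {0..\<lfloor>2 ^ n * b\<rfloor>})"
          unfolding s_def by (intro image_eqI[where x = "(sgn (\<phi> x), \<lfloor>2 ^ n * \<bar>\<phi> x\<bar>\<rfloor>)"]) auto
      qed
    qed simp
    moreover have "s n \<in> borel_measurable borel"
      unfolding s_def by measurable
    ultimately have "simple_function borel (s n)"
      by (intro simple_function_borel_measurable) (simp_all add: space_borel)
    moreover have "bounded {x. s n x \<noteq> 0}"
      using test_functionD(2)[OF \<phi>]
      by (auto simp: bdd_borel_def s_def sgn_eq_0_iff intro: bounded_subset)
    ultimately show "bdd_simple (s n)"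
      by (simp add: bdd_simple_def)
  next
    fix n x
    show "\<bar>s n x\<bar> \<le> \<bar>\<phi> x\<bar>"
      using le[of n x] by (auto simp: s_def sgn_if abs_mult split: if_splits)
    show approx: "\<bar>s n x - \<phi> x\<bar> \<le> (1/2) ^ n * indicator {x. \<phi> x \<noteq> 0} x" for n
      using le[of n x] ge[of x n] unfolding s_def indicator_def
      by (cases "\<phi> x" "0::real" rule: linorder_cases) auto
    have "(\<lambda>n. (1/2) ^ n * indicator {x. \<phi> x \<noteq> 0} x :: real) \<longlonglongrightarrow> 0"
      by (intro tendsto_mult_left_zero LIMSEQ_power_zero) simp
    then have "(\<lambda>n. s n x - \<phi> x) \<longlonglongrightarrow> 0"
      by (rule Lim_null_comparison[rotated]) (use approx in auto)
    then show "(\<lambda>n. s n x) \<longlonglongrightarrow> \<phi> x"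
      by (simp add: LIM_zero_iff)
  qed
qed

lemma bdd_simple_representation:
  assumes s: "bdd_simple s"
  shows "finite (range s - {0})" "\<And>c. c \<in> range s - {0} \<Longrightarrow> s -` {c} \<in> bdd_borel"
    "\<And>x. (\<Sum>c\<in>range s - {0}. c * indicator (s -` {c}) x) = s x"
    "s \<in> borel_measurable borel"
proof -
  have sf: "simple_function borel s"
    using s by (simp add: bdd_simple_def)
  show fin: "finite (range s - {0})"
    using simple_functionD(1)[OF sf] by (simp add: space_borel)
  show "s \<in> borel_measurable borel"
    by (rule borel_measurable_simple_function[OF sf])
  show "s -` {c} \<in> bdd_borel" if "c \<in> range s - {0}" for c
  proof -
    have "s -` {c} \<subseteq> {x. s x \<noteq> 0}"
      using that by auto
    then show ?thesis
      using s simple_functionD(2)[OF sf, of "{c}"]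
      by (auto simp: bdd_borel_def bdd_simple_def intro: bounded_subset)
  qed
  show "(\<Sum>c\<in>range s - {0}. c * indicator (s -` {c}) x) = s x" for x
  proof -
    have "(\<Sum>c\<in>range s - {0}. c * indicator (s -` {c}) x) = (\<Sum>c\<in>range s - {0}. if s x = c then c else 0)"
      by (intro sum.cong) (auto simp: indicator_def)
    also have "\<dots> = s x"
      using fin by (simp add: sum.delta)
    finally show ?thesis .
  qed
qed

text \<open>A disjoint sum as index set writes the difference of two simple integrals as one finite
  combination over the level sets of both functions, without a common refinement.\<close>

definition diff_index :: "('a \<Rightarrow> real) \<Rightarrow> ('a \<Rightarrow> real) \<Rightarrow> (real + real) set" where
  "diff_index s t = (range s - {0}) <+> (range t - {0})"

definition diff_set :: "('a \<Rightarrow> real) \<Rightarrow> ('a \<Rightarrow> real) \<Rightarrow> real + real \<Rightarrow> 'a set" where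
  "diff_set s t = case_sum (\<lambda>c. s -` {c}) (\<lambda>c. t -` {c})"

definition diff_coeff :: "real + real \<Rightarrow> real" where
  "diff_coeff = case_sum (\<lambda>c. c) uminus"

section \<open>Existence of the stochastic integral and its inner products\<close>

context second_order_rm
begin

lemma square_integrable_simple:
  "bdd_simple s \<Longrightarrow> square_integrable P (simple_rm_integral M s)"
  unfolding simple_rm_integral_def
  by (intro square_integrable_combination bdd_simple_representation)

lemma ip_simple:
  assumes "square_integrable P Z" "bdd_simple s"
  shows "ip P Z (simple_rm_integral M s) = pairing (\<lambda>A. ip P Z (M A)) s"
proof -
  note s = bdd_simple_representation[OF assms(2)]
  have "ip P Z (simple_rm_integral M s) = (\<Sum>c\<in>range s - {0}. c * ip P Z (M (s -` {c})))"
    unfolding simple_rm_integral_def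
    using assms(1)
    by (subst ip_sum_right) (auto intro!: square_integrable_cmult sq_M s(2) simp: ip_cmult_right)
  also have "\<dots> = pairing (\<lambda>A. ip P Z (M A)) (\<lambda>x. \<Sum>c\<in>range s - {0}. c * indicator (s -` {c}) x)"
    by (rule pairing_sum_indicator[OF real_measure_ip[OF assms(1)] s(1,2), symmetric])
  finally show ?thesis
    by (simp only: s(3))
qed

lemma
  assumes "bdd_simple s" "bdd_simple t"
  shows finite_diff_index: "finite (diff_index s t)"
    and diff_set_bdd_borel: "\<And>i. i \<in> diff_index s t \<Longrightarrow> diff_set s t i \<in> bdd_borel"
    and sum_diff_indicator:
      "\<And>x. (\<Sum>i\<in>diff_index s t. diff_coeff i * indicator (diff_set s t i) x) = s x - t x"
    and sum_diff_rm: "\<And>\<omega>. (\<Sum>i\<in>diff_index s t. diff_coeff i * M (diff_set s t i) \<omega>)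
      = simple_rm_integral M s \<omega> - simple_rm_integral M t \<omega>"
proof -
  note s = bdd_simple_representation[OF assms(1)] and t = bdd_simple_representation[OF assms(2)]
  note defs = diff_index_def diff_set_def diff_coeff_def
  have sum: "(\<Sum>i\<in>diff_index s t. diff_coeff i * F (diff_set s t i))
      = (\<Sum>a\<in>range s - {0}. a * F (s -` {a})) - (\<Sum>a\<in>range t - {0}. a * F (t -` {a}))"
    for F :: "'a set \<Rightarrow> real"
    unfolding diff_index_def
    by (subst sum.Plus[OF s(1) t(1)]) (simp add: defs comp_def sum_negf)
  show "finite (diff_index s t)"
    unfolding defs by (intro finite_Plus s t)
  show "diff_set s t i \<in> bdd_borel" if "i \<in> diff_index s t" for i
    using that unfolding defs by (rule PlusE) (simp_all only: sum.case s(2) t(2))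
  show "(\<Sum>i\<in>diff_index s t. diff_coeff i * indicator (diff_set s t i) x) = s x - t x" for x
    unfolding sum[of "\<lambda>B. indicator B x"] s(3) t(3) by (rule refl)
  show "(\<Sum>i\<in>diff_index s t. diff_coeff i * M (diff_set s t i) \<omega>)
      = simple_rm_integral M s \<omega> - simple_rm_integral M t \<omega>" for \<omega>
    unfolding sum[of "\<lambda>B. M B \<omega>"] simple_rm_integral_def by (rule refl)
qed

lemma L2norm_simple_diff_le:
  assumes st: "bdd_simple s" "bdd_simple t" and K: "K \<in> bdd_borel" and r: "0 \<le> r"
    and le: "\<And>x. \<bar>s x - t x\<bar> \<le> r * indicator K x"
  shows "L2norm P (\<lambda>\<omega>. simple_rm_integral M s \<omega> - simple_rm_integral M t \<omega>)
    \<le> r * sqrt (measure (total_var C) (K \<times> K))"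
proof (rule power2_le_imp_le)
  have "(L2norm P (\<lambda>\<omega>. \<Sum>i\<in>diff_index s t. diff_coeff i * M (diff_set s t i) \<omega>))\<^sup>2
      \<le> r\<^sup>2 * measure (total_var C) (K \<times> K)"
    by (rule L2norm_combination_le[OF finite_diff_index[OF st] diff_set_bdd_borel[OF st] K])
      (simp_all only: sum_diff_indicator[OF st] le)
  then show "(L2norm P (\<lambda>\<omega>. simple_rm_integral M s \<omega> - simple_rm_integral M t \<omega>))\<^sup>2
      \<le> (r * sqrt (measure (total_var C) (K \<times> K)))\<^sup>2"
    by (simp add: sum_diff_rm[OF st] power_mult_distrib)
qed (use r in auto)

lemma L2norm_simple_diff_LIMSEQ:
  assumes st: "\<And>n. bdd_simple (s n)" "\<And>n. bdd_simple (t n)" and K: "K \<in> bdd_borel"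
    and le: "\<And>n x. \<bar>s n x - t n x\<bar> \<le> r * indicator K x"
    and lim: "\<And>x. (\<lambda>n. s n x - t n x) \<longlonglongrightarrow> 0"
  shows "(\<lambda>n. L2norm P (\<lambda>\<omega>. simple_rm_integral M (s n) \<omega> - simple_rm_integral M (t n) \<omega>)) \<longlonglongrightarrow> 0"
proof -
  have "(\<lambda>n. L2norm P (\<lambda>\<omega>. \<Sum>i\<in>diff_index (s n) (t n). diff_coeff i * M (diff_set (s n) (t n) i) \<omega>))
      \<longlonglongrightarrow> 0"
    by (rule L2norm_combination_LIMSEQ[OF finite_diff_index[OF st] diff_set_bdd_borel[OF st] K, where r = r])
      (simp_all only: sum_diff_indicator[OF st] le lim)
  then show ?thesis
    by (simp add: sum_diff_rm[OF st])
qed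

text \<open>The dyadic approximations yield a limit by completeness. Any other admissible sequence
  has the same limit, since its difference to them is dominated by
  \<open>2 * \<bar>\<phi> x\<bar>\<close> and tends to 0 pointwise.\<close>

lemma rm_integral_exists:
  assumes \<phi>: "test_function \<phi>"
  shows "\<exists>Y. square_integrable P Y \<and>
     (\<forall>s. (\<forall>n. bdd_simple (s n)) \<longrightarrow> (\<forall>x. (\<lambda>n. s n x) \<longlonglongrightarrow> \<phi> x) \<longrightarrow>
        (\<forall>n x. \<bar>s n x\<bar> \<le> \<bar>\<phi> x\<bar>) \<longrightarrow> L2_tendsto P (\<lambda>n. simple_rm_integral M (s n)) Y)"
proof -
  define K where "K = {x. \<phi> x \<noteq> 0}"
  have K: "K \<in> bdd_borel"
    unfolding K_def by (rule test_functionD(2)[OF \<phi>])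
  obtain b where b: "\<And>x. \<bar>\<phi> x\<bar> \<le> b * indicator K x"
    using test_functionD(3)[OF \<phi>] unfolding K_def by auto
  obtain s where s: "\<And>n. bdd_simple (s n)" "\<And>n x. \<bar>s n x\<bar> \<le> \<bar>\<phi> x\<bar>"
    "\<And>n x. \<bar>s n x - \<phi> x\<bar> \<le> (1/2) ^ n * indicator K x"
    and s_lim: "\<And>x. (\<lambda>n. s n x) \<longlonglongrightarrow> \<phi> x"
    using test_function_uniform_approx[OF \<phi>] unfolding K_def by metis
  obtain Y where Y: "square_integrable P Y"
    "(\<lambda>n. L2norm P (\<lambda>\<omega>. simple_rm_integral M (s n) \<omega> - Y \<omega>)) \<longlonglongrightarrow> 0"
  proof (rule L2_complete)
    show "square_integrable P (simple_rm_integral M (s n))" for n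
      by (rule square_integrable_simple[OF s(1)])
    fix n
    \<comment> \<open>Two consecutive errors, \<open>(1/2) ^ n\<close> and
      \<open>(1/2) ^ Suc n\<close>, together stay below \<open>2 * (1/2) ^ n\<close>.\<close>
    have "L2norm P (\<lambda>\<omega>. simple_rm_integral M (s (Suc n)) \<omega> - simple_rm_integral M (s n) \<omega>)
        \<le> (2 * (1/2) ^ n) * sqrt (measure (total_var C) (K \<times> K))"
    proof (rule L2norm_simple_diff_le[OF s(1) s(1) K])
      fix x
      have "(1/2) ^ Suc n * indicator K x \<le> ((1/2) ^ n * indicator K x :: real)"
        by (simp add: indicator_def)
      then show "\<bar>s (Suc n) x - s n x\<bar> \<le> 2 * (1/2) ^ n * indicator K x"
        using s(3)[of n x] s(3)[of "Suc n" x] by linarith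
    qed simp
    then show "L2norm P (\<lambda>\<omega>. simple_rm_integral M (s (Suc n)) \<omega> - simple_rm_integral M (s n) \<omega>)
        \<le> (2 * sqrt (measure (total_var C) (K \<times> K))) * (1/2) ^ n"
      by (simp add: mult_ac)
  qed
  show ?thesis
  proof (intro exI[of _ Y] conjI Y(1) allI impI)
    fix t assume t: "\<forall>n. bdd_simple (t n)" "\<forall>x. (\<lambda>n. t n x) \<longlonglongrightarrow> \<phi> x" "\<forall>n x. \<bar>t n x\<bar> \<le> \<bar>\<phi> x\<bar>"
    note sq = square_integrable_simple[OF s(1)] square_integrable_simple[OF t(1)[rule_format]]
    have "(\<lambda>n. L2norm P (\<lambda>\<omega>. simple_rm_integral M (t n) \<omega> - simple_rm_integral M (s n) \<omega>)) \<longlonglongrightarrow> 0"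
    proof (rule L2norm_simple_diff_LIMSEQ[OF _ s(1) K])
      fix n x
      have "\<bar>t n x - s n x\<bar> \<le> \<bar>\<phi> x\<bar> + \<bar>\<phi> x\<bar>"
        using s(2)[of n x] t(3) by (meson abs_triangle_ineq4 add_mono order_trans)
      then show "\<bar>t n x - s n x\<bar> \<le> 2 * b * indicator K x"
        using b[of x] by linarith
    next
      show "(\<lambda>n. t n x - s n x) \<longlonglongrightarrow> 0" for x
        using tendsto_diff[OF t(2)[rule_format, of x] s_lim[of x]] by simp
    qed (use t in auto)
    from tendsto_add[OF this Y(2)]
    have lim: "(\<lambda>n. L2norm P (\<lambda>\<omega>. simple_rm_integral M (t n) \<omega> - simple_rm_integral M (s n) \<omega>) +
        L2norm P (\<lambda>\<omega>. simple_rm_integral M (s n) \<omega> - Y \<omega>)) \<longlonglongrightarrow> 0"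
      by simp
    have le: "norm (L2norm P (\<lambda>\<omega>. simple_rm_integral M (t n) \<omega> - Y \<omega>))
        \<le> L2norm P (\<lambda>\<omega>. simple_rm_integral M (t n) \<omega> - simple_rm_integral M (s n) \<omega>) +
          L2norm P (\<lambda>\<omega>. simple_rm_integral M (s n) \<omega> - Y \<omega>)" for n
      using L2norm_triangle_diff[OF sq(2) sq(1) Y(1)] by simp
    have "(\<lambda>n. L2norm P (\<lambda>\<omega>. simple_rm_integral M (t n) \<omega> - Y \<omega>)) \<longlonglongrightarrow> 0"
      by (rule Lim_null_comparison[OF always_eventually[OF allI[OF le]] lim])
    then show "L2_tendsto P (\<lambda>n. simple_rm_integral M (t n)) Y"
      by (simp add: L2_tendsto_iff sq Y)
  qed
qed

lemma
  assumes \<phi>: "test_function \<phi>"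
  shows square_integrable_rm_integral: "square_integrable P (rm_integral P M \<phi>)"
    and rm_integral_approx: "\<exists>s b. (\<forall>n. bdd_simple (s n)) \<and> (\<forall>x. (\<lambda>n. s n x) \<longlonglongrightarrow> \<phi> x) \<and>
        (\<forall>n x. \<bar>s n x\<bar> \<le> b * indicator {x. \<phi> x \<noteq> 0} x) \<and>
        (\<lambda>n. L2norm P (\<lambda>\<omega>. simple_rm_integral M (s n) \<omega> - rm_integral P M \<phi> \<omega>)) \<longlonglongrightarrow> 0"
proof -
  have Y: "square_integrable P (rm_integral P M \<phi>)"
    "\<And>s. (\<forall>n. bdd_simple (s n)) \<Longrightarrow> (\<forall>x. (\<lambda>n. s n x) \<longlonglongrightarrow> \<phi> x) \<Longrightarrow>
        (\<forall>n x. \<bar>s n x\<bar> \<le> \<bar>\<phi> x\<bar>) \<Longrightarrow> L2_tendsto P (\<lambda>n. simple_rm_integral M (s n)) (rm_integral P M \<phi>)"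
    using someI_ex[OF rm_integral_exists[OF \<phi>]] unfolding rm_integral_def by blast+
  show "square_integrable P (rm_integral P M \<phi>)"
    by (rule Y)
  obtain b where b: "\<And>x. \<bar>\<phi> x\<bar> \<le> b * indicator {x. \<phi> x \<noteq> 0} x"
    using test_functionD(3)[OF \<phi>] by auto
  obtain s where s: "\<And>n. bdd_simple (s n)" "\<And>n x. \<bar>s n x\<bar> \<le> \<bar>\<phi> x\<bar>"
    and s_lim: "\<And>x. (\<lambda>n. s n x) \<longlonglongrightarrow> \<phi> x"
    using test_function_uniform_approx[OF \<phi>] by metis
  have "L2_tendsto P (\<lambda>n. simple_rm_integral M (s n)) (rm_integral P M \<phi>)"
    using s s_lim by (intro Y) auto
  then have "(\<lambda>n. L2norm P (\<lambda>\<omega>. simple_rm_integral M (s n) \<omega> - rm_integral P M \<phi> \<omega>)) \<longlonglongrightarrow> 0"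
    by (simp add: L2_tendsto_iff square_integrable_simple s Y)
  then show "\<exists>s b. (\<forall>n. bdd_simple (s n)) \<and> (\<forall>x. (\<lambda>n. s n x) \<longlonglongrightarrow> \<phi> x) \<and>
        (\<forall>n x. \<bar>s n x\<bar> \<le> b * indicator {x. \<phi> x \<noteq> 0} x) \<and>
        (\<lambda>n. L2norm P (\<lambda>\<omega>. simple_rm_integral M (s n) \<omega> - rm_integral P M \<phi> \<omega>)) \<longlonglongrightarrow> 0"
    using s s_lim order_trans[OF s(2) b] by blast
qed

text \<open>Both sides are limits of the values at simple functions, by L2 continuity and by
  dominated convergence. Fourier coefficients of the integral thus become pairings with the measures
  of the expansion.\<close>

lemma ip_rm_integral:
  assumes Z: "square_integrable P Z" and \<phi>: "test_function \<phi>"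
  shows "ip P Z (rm_integral P M \<phi>) = pairing (\<lambda>A. ip P Z (M A)) \<phi>"
proof -
  obtain s b where s: "\<And>n. bdd_simple (s n)" "\<And>x. (\<lambda>n. s n x) \<longlonglongrightarrow> \<phi> x"
    "\<And>n x. \<bar>s n x\<bar> \<le> b * indicator {x. \<phi> x \<noteq> 0} x"
    "(\<lambda>n. L2norm P (\<lambda>\<omega>. simple_rm_integral M (s n) \<omega> - rm_integral P M \<phi> \<omega>)) \<longlonglongrightarrow> 0"
    using rm_integral_approx[OF \<phi>] by auto
  have "(\<lambda>n. ip P Z (simple_rm_integral M (s n))) \<longlonglongrightarrow> ip P Z (rm_integral P M \<phi>)"
    by (intro ip_LIMSEQ square_integrable_simple square_integrable_rm_integral \<phi> s Z)
  moreover have "(\<lambda>n. ip P Z (simple_rm_integral M (s n))) \<longlonglongrightarrow> pairing (\<lambda>A. ip P Z (M A)) \<phi>"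
    unfolding ip_simple[OF Z s(1)]
    by (rule pairing_LIMSEQ[OF real_measure_ip[OF Z] bdd_simple_representation(4)[OF s(1)]
          test_functionD(2)[OF \<phi>] s(3,2)])
  ultimately show ?thesis
    by (rule LIMSEQ_unique)
qed

text \<open>It turns the covariance measure with one argument fixed into an inner product with
  \<open>M B\<close>, so that removing a partial sum leaves the inner product of the remainder with
  \<open>M B\<close>.\<close>

lemma ip_rm_integral_measure:
  assumes \<phi>: "test_function \<phi>" and B: "B \<in> bdd_borel"
  shows "ip P (rm_integral P M \<phi>) (M B) = pairing C (tensor \<phi> (indicator B))"
proof -
  obtain s b where s: "\<And>n. bdd_simple (s n)" "\<And>x. (\<lambda>n. s n x) \<longlonglongrightarrow> \<phi> x"
    "\<And>n x. \<bar>s n x\<bar> \<le> b * indicator {x. \<phi> x \<noteq> 0} x"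
    "(\<lambda>n. L2norm P (\<lambda>\<omega>. simple_rm_integral M (s n) \<omega> - rm_integral P M \<phi> \<omega>)) \<longlonglongrightarrow> 0"
    using rm_integral_approx[OF \<phi>] by auto
  have eq: "ip P (simple_rm_integral M (s n)) (M B) = pairing C (tensor (s n) (indicator B))" for n
    using ip_combination[OF bdd_simple_representation(1,2)[OF s(1)[of n]], where J = "{()}" and B = "\<lambda>_. B" and c = "\<lambda>c. c" and d = "\<lambda>_. 1"] B
    by (simp add: simple_rm_integral_def bdd_simple_representation(3)[OF s(1)])
  have [measurable]: "s n \<in> borel_measurable borel" "B \<in> sets borel" for n
    by (auto intro: bdd_simple_representation s bdd_borel_sets B)
  have "(\<lambda>n. ip P (M B) (simple_rm_integral M (s n))) \<longlonglongrightarrow> ip P (M B) (rm_integral P M \<phi>)"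
    by (intro ip_LIMSEQ square_integrable_simple square_integrable_rm_integral \<phi> s sq_M B)
  moreover have "(\<lambda>n. pairing C (tensor (s n) (indicator B))) \<longlonglongrightarrow> pairing C (tensor \<phi> (indicator B))"
  proof (rule pairing_LIMSEQ[OF real_measure_C _ bdd_borel_Times[OF test_functionD(2)[OF \<phi>] B]])
    fix n z
    show "\<bar>tensor (s n) (indicator B) z\<bar> \<le> b * indicator ({x. \<phi> x \<noteq> 0} \<times> B) z"
      using s(3)[of n "fst z"] by (cases z) (auto simp: indicator_def)
  next
    fix z
    show "(\<lambda>n. tensor (s n) (indicator B) z) \<longlonglongrightarrow> tensor \<phi> (indicator B) z"
      by (cases z) (auto intro!: tendsto_intros s)
  qed measurable
  ultimately show ?thesis
    using LIMSEQ_unique by (simp add: ip_commute[of P "M B"] eq)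
qed

lemma spanned_rm_integral:
  assumes "orthonormal P e" "\<And>A. A \<in> bdd_borel \<Longrightarrow> orthonormal.spanned P e (M A)" "test_function \<phi>"
  shows "orthonormal.spanned P e (rm_integral P M \<phi>)"
proof -
  interpret orthonormal P e
    by fact
  obtain s where s: "\<And>n. bdd_simple (s n)"
    "(\<lambda>n. L2norm P (\<lambda>\<omega>. simple_rm_integral M (s n) \<omega> - rm_integral P M \<phi> \<omega>)) \<longlonglongrightarrow> 0"
    using rm_integral_approx[OF assms(3)] by auto
  have "spanned (simple_rm_integral M (s n))" for n
    unfolding simple_rm_integral_def
    using bdd_simple_representation(2)[OF s(1)] assms(2) by (intro spanned_sum spanned_cmult) auto
  then show ?thesis
    by (rule spanned_limit[OF _ square_integrable_rm_integral[OF assms(3)] s(2)])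
qed

end

section \<open>A countable total family\<close>

text \<open>Finite intersections of a countable basis again form a countable basis, now stable under
  intersection. Boundedness is imposed afterwards by intersecting with balls.\<close>

lemma countable_bdd_generator:
  obtains G :: "'a::euclidean_space set set"
  where "countable G" "Int_stable G" "sets borel = sigma_sets UNIV G"
proof -
  obtain B :: "'a set set" where B: "countable B" "topological_basis B"
    using ex_countable_basis by blast
  define G where "G = Inter ` {F. F \<subseteq> B \<and> finite F}"
  have G: "countable G"
    unfolding G_def using countable_Collect_finite_subset[OF B(1)] by (simp add: conj_commute)
  have "topological_basis G"
    unfolding topological_basis_def
  proof (intro conjI allI ballI impI)
    show "open b" if "b \<in> G" for b
      using that topological_basis_open[OF B(2)] by (auto simp: G_def)
    fix S :: "'a set" assume "open S"
    then obtain B' where "B' \<subseteq> B" "\<Union>B' = S"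
      using B(2) by (auto simp: topological_basis_def)
    moreover have "B \<subseteq> G"
      unfolding G_def by (auto intro: image_eqI[where x = "{_}"])
    ultimately show "\<exists>B'\<subseteq>G. \<Union>B' = S"
      by blast
  qed
  then have "sets borel = sigma_sets UNIV G"
    by (subst borel_eq_countable_basis[OF G]) auto
  moreover have "Int_stable G"
  proof (rule Int_stableI)
    fix a b assume "a \<in> G" "b \<in> G"
    then obtain F F' where F: "F \<subseteq> B" "finite F" "a = \<Inter>F" "F' \<subseteq> B" "finite F'" "b = \<Inter>F'"
      by (auto simp: G_def)
    then show "a \<inter> b \<in> G"
      unfolding G_def by (intro image_eqI[where x = "F \<union> F'"]) auto
  qed
  ultimately show ?thesis
    using G that by blast
qed

context second_order_rm
begin

text \<open>Dynkin's argument inside a fixed ball. The sequence is chosen before the orthonormal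
  family, which Gram-Schmidt will produce from it; hence the conclusion quantifies over
  \<open>e\<close>.\<close>

lemma total_sequence:
  obtains g :: "nat \<Rightarrow> 'a set"
  where "\<And>k. g k \<in> bdd_borel"
    and "\<And>e A. orthonormal P e \<Longrightarrow> (\<And>k. orthonormal.spanned P e (M (g k))) \<Longrightarrow> A \<in> bdd_borel \<Longrightarrow>
      orthonormal.spanned P e (M A)"
proof -
  obtain G :: "'a set set" where G: "countable G" "Int_stable G" "sets borel = sigma_sets UNIV G"
    by (rule countable_bdd_generator)
  \<comment> \<open>The balls themselves belong to \<open>H\<close> because complements will be
    taken relative to a ball.\<close>
  define H where "H = insert {} ((\<lambda>(B, m). B \<inter> ball 0 (real m)) ` (G \<times> (UNIV :: nat set))
      \<union> range (\<lambda>m. ball 0 (real m)))"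
  have H: "countable H" "H \<noteq> {}"
    unfolding H_def using G by auto
  have G_borel: "B \<in> sets borel" if "B \<in> G" for B
    using that G(3) by (simp add: sigma_sets.Basic)
  have H_bdd: "B \<in> bdd_borel" if "B \<in> H" for B
    using that bdd_borel_Int[OF bdd_borel_ball G_borel] unfolding H_def by (auto simp: Int_commute)
  define g where "g = from_nat_into H"
  have range_g: "range g = H"
    unfolding g_def by (rule range_from_nat_into[OF H(2,1)])
  show ?thesis
  proof (rule that[of g])
    show "g k \<in> bdd_borel" for k
      using range_g H_bdd by auto
    fix e and A :: "'a set"
    assume e: "orthonormal P e" and sp: "\<And>k. orthonormal.spanned P e (M (g k))"
      and A: "A \<in> bdd_borel"
    interpret orthonormal P e
      by fact
    have spH: "spanned (M B)" if "B \<in> H" for B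
      using that sp range_g by (metis rangeE)
    obtain m :: nat where m: "A \<subseteq> ball 0 (real m)"
      by (rule bdd_borel_subset_ball[OF A])
    define W where "W = ball (0::'a) (real m)"
    have W: "W \<in> bdd_borel" "W \<in> H"
      unfolding W_def H_def by auto
    have G_Pow: "G \<subseteq> Pow UNIV"
      by simp
    have "A \<in> sigma_sets UNIV G"
      using A G(3) bdd_borel_sets by blast
    \<comment> \<open>Induction over the generated sets leaves the bounded ones, so each set is
      tested through its trace on \<open>W\<close>.\<close>
    then have "spanned (M (A \<inter> W))"
    proof (induction A rule: sigma_sets_induct_disjoint
          [OF G(2) G_Pow, consumes 1, case_names basic empty compl union])
      case (basic A)
      then show ?case
        unfolding W_def by (intro spH) (auto simp: H_def)
    next
      case empty
      then show ?case
        by (auto intro: spH simp: H_def)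
    next
      case (compl A)
      have "A \<in> sets borel"
        using compl(1) G(3) by simp
      then have "A \<inter> W \<in> bdd_borel"
        using bdd_borel_Int[OF W(1), of A] by (simp add: Int_commute)
      then have AW: "A \<inter> W \<in> sets borel" "W - A \<inter> W \<in> bdd_borel"
        using bdd_borel_sets bdd_borel_Diff[OF W(1)] by blast+
      have "L2norm P (\<lambda>\<omega>. (M W \<omega> + (-1) * M (A \<inter> W) \<omega>) - M (W - A \<inter> W) \<omega>) = 0"
        using L2norm_additive[OF W(1) AW(1)] by simp
      then have "spanned (M (W - A \<inter> W))"
        by (rule spanned_cong[OF spanned_add[OF spH[OF W(2)] spanned_cmult[OF compl(2)]] sq_M[OF AW(2)]])
      moreover have "W - A \<inter> W = (UNIV - A) \<inter> W"
        by auto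
      ultimately show ?case
        by simp
    next
      case (union A)
      have AW: "A i \<inter> W \<in> bdd_borel" for i
        using bdd_borel_Int[OF W(1), of "A i"] union(2) G(3) by (auto simp: Int_commute)
      have UW: "(\<Union>i. A i) \<inter> W = (\<Union>i. A i \<inter> W)"
        by auto
      have U: "(\<Union>i. A i \<inter> W) \<in> bdd_borel"
        using bdd_borel_sets[OF AW] by (intro bdd_borel_subset[OF W(1)] sets.countable_nat_UN) auto
      have d: "disjoint_family (\<lambda>i. A i \<inter> W)"
        using union(1) by (auto simp: disjoint_family_on_def)
      show ?case
        unfolding UW
        by (rule spanned_limit[OF spanned_sum[OF union(3)] sq_M[OF U] L2norm_sigma_additive[OF AW d U]])
    qed
    moreover have "A \<inter> W = A"
      using m by (auto simp: W_def)
    ultimately show "spanned (M A)"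
      by simp
  qed
qed

end

section \<open>Atoms and regulated measures\<close>

text \<open>Restricted to a ball, the total variation is a finite measure and has countably many
  atoms. Balls of integer radius exhaust the space.\<close>

lemma countable_atoms:
  assumes \<mu>: "real_measure \<mu>"
  shows "countable {x. \<mu> {x} \<noteq> 0}"
proof -
  define T where "T m = density (total_var \<mu>) (indicator (ball 0 (real m)))" for m
  have emeasure_T: "emeasure (T m) A = emeasure (total_var \<mu>) (ball 0 (real m) \<inter> A)"
    if "A \<in> sets borel" for m A
    unfolding T_def using that \<mu> by (intro emeasure_restricted) auto
  have fin: "finite_measure (T m)" for m
  proof (rule finite_measureI)
    have "space (T m) = UNIV"
      using sets_eq_imp_space_eq[OF sets_total_var[OF \<mu>]] by (simp add: T_def space_borel)
    then show "emeasure (T m) (space (T m)) \<noteq> \<infinity>"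
      using total_var_finite[OF \<mu> bdd_borel_ball, of "real m"] by (simp add: emeasure_T less_top)
  qed
  have "{x. \<mu> {x} \<noteq> 0} \<subseteq> (\<Union>m. {x. measure (T m) {x} \<noteq> 0})"
  proof
    fix x assume "x \<in> {x. \<mu> {x} \<noteq> 0}"
    then have x: "\<mu> {x} \<noteq> 0"
      by simp
    have bx: "{x} \<in> bdd_borel"
      by (simp add: bdd_borel_def)
    obtain m :: nat where "{x} \<subseteq> ball 0 (real m)"
      by (rule bdd_borel_subset_ball[OF bx])
    then have "ball 0 (real m) \<inter> {x} = {x}"
      by auto
    then have "measure (T m) {x} = measure (total_var \<mu>) {x}"
      by (simp add: measure_def emeasure_T)
    moreover have "\<bar>\<mu> {x}\<bar> \<le> 1 * measure (total_var \<mu>) {x}"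
      unfolding pairing_indicator[OF \<mu> bx, symmetric]
      by (rule abs_pairing_le[OF \<mu> _ bx]) auto
    ultimately have "measure (T m) {x} \<noteq> 0"
      using x by auto
    then show "x \<in> (\<Union>m. {x. measure (T m) {x} \<noteq> 0})"
      by auto
  qed
  moreover have "countable (\<Union>m. {x. measure (T m) {x} \<noteq> 0})"
    using finite_measure.countable_support[OF fin] by auto
  ultimately show ?thesis
    by (rule countable_subset)
qed

lemma real_measure_dirac: "real_measure (\<lambda>A. indicator A x)"
  unfolding real_measure_def sums_def
proof (intro allI impI)
  fix A :: "nat \<Rightarrow> 'a set"
  assume "disjoint_family A"
  then have "(\<Sum>i<n. indicator (A i) x) = (indicator (\<Union>i<n. A i) x :: real)" for n
    by (intro indicator_UN_disjoint[symmetric]) (auto simp: disjoint_family_on_def)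
  then show "(\<lambda>n. \<Sum>i<n. indicator (A i) x :: real) \<longlonglongrightarrow> indicator (\<Union>n. A n) x"
    using LIMSEQ_indicator_UN[of A x] by simp
qed

text \<open>The variation is dominated by the point mass at \<open>x\<close>, so
  \<open>1 / f\<close> may be replaced by the constant \<open>1 / f x\<close>.\<close>

lemma regulated_measure_dirac:
  assumes [measurable]: "f \<in> borel_measurable borel"
  shows "regulated_measure f (\<lambda>A. indicator A x)"
proof -
  let ?T = "total_var (\<lambda>A. indicator A x)"
  note sets_total_var[OF real_measure_dirac, measurable_cong]
  have le: "emeasure ?T A \<le> indicator A x" if "A \<in> sets borel" for A
  proof (rule emeasure_total_var_le[OF real_measure_dirac that])
    fix D E assume "D \<subseteq> A"
    then have "ennreal (indicator D x - indicator E x) \<le> ennreal (indicator A x)"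
      by (intro ennreal_leI) (auto simp: indicator_def)
    then show "ennreal (indicator D x - indicator E x) \<le> indicator A x"
      by (simp add: ennreal_indicator)
  qed
  have space: "space ?T = UNIV"
    using sets_eq_imp_space_eq[OF sets_total_var[OF real_measure_dirac, of x]] by (simp add: space_borel)
  have "emeasure ?T (- {x}) = 0"
    using le[of "- {x}"] by auto
  then have "- {x} \<in> null_sets ?T"
    by (simp add: null_sets_def real_measure_dirac)
  then have "AE y in ?T. y = x"
    by (auto dest: AE_not_in)
  then have "(\<integral>\<^sup>+y. ennreal (1 / f y) \<partial>?T) = (\<integral>\<^sup>+y. ennreal (1 / f x) \<partial>?T)"
    by (intro nn_integral_cong_AE) auto
  also have "\<dots> = ennreal (1 / f x) * emeasure ?T UNIV"
    by (simp add: space)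
  also have "\<dots> \<le> ennreal (1 / f x) * 1"
    using le[of UNIV] by (intro mult_left_mono) auto
  also have "\<dots> < \<infinity>"
    by simp
  finally show ?thesis
    by (simp add: regulated_measure_def)
qed

lemma total_var_uminus: "total_var (\<lambda>A. - \<mu> A) = total_var \<mu>"
  by (simp add: total_var_def)

lemma pairing_uminus: "pairing (\<lambda>A. - \<mu> A) \<phi> = - pairing \<mu> \<phi>"
  by (simp add: pairing_def)

section \<open>Hahn decomposition and integrability of 1 / f\<close>

text \<open>A Hahn set for the two Jordan parts only compares them. Where one part is dominated by
  the other on all Borel subsets, the signed measure has constant sign there, so the supremum
  defining the dominated part is 0.\<close>

lemma real_measure_Hahn:
  assumes \<mu>: "real_measure \<mu>" and E: "E \<in> bdd_borel"
  obtains D where "D \<in> sets borel" "D \<subseteq> E"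
    "emeasure (pos_var (\<lambda>A. - \<mu> A)) D = 0" "emeasure (pos_var \<mu>) (E - D) = 0"
proof -
  note m = real_measure_uminus[OF \<mu>]
  have "\<exists>D\<in>sets (pos_var \<mu>). D \<subseteq> E \<and>
      (\<forall>X\<in>sets (pos_var \<mu>). X \<subseteq> D \<longrightarrow> emeasure (pos_var (\<lambda>A. - \<mu> A)) X \<le> emeasure (pos_var \<mu>) X) \<and>
      (\<forall>X\<in>sets (pos_var \<mu>). X \<subseteq> E \<longrightarrow> X \<inter> D = {} \<longrightarrow>
        emeasure (pos_var \<mu>) X \<le> emeasure (pos_var (\<lambda>A. - \<mu> A)) X)"
    using pos_var_finite[OF \<mu> E] pos_var_finite[OF m E] bdd_borel_sets[OF E]
    by (intro unsigned_Hahn_decomposition) (auto simp: \<mu> m less_top)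
  then obtain D where D: "D \<in> sets borel" "D \<subseteq> E"
    and le: "\<And>X. X \<in> sets borel \<Longrightarrow> X \<subseteq> D \<Longrightarrow> emeasure (pos_var (\<lambda>A. - \<mu> A)) X \<le> emeasure (pos_var \<mu>) X"
    and ge: "\<And>X. X \<in> sets borel \<Longrightarrow> X \<subseteq> E \<Longrightarrow> X \<inter> D = {} \<Longrightarrow>
      emeasure (pos_var \<mu>) X \<le> emeasure (pos_var (\<lambda>A. - \<mu> A)) X"
    by (auto simp: \<mu>)
  have zero: "emeasure (pos_var \<nu>) A = 0"
    if \<nu>: "real_measure \<nu>" and A: "A \<in> bdd_borel"
      and le: "\<And>X. X \<in> sets borel \<Longrightarrow> X \<subseteq> A \<Longrightarrow> emeasure (pos_var \<nu>) X \<le> emeasure (pos_var (\<lambda>A. - \<nu> A)) X"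
    for \<nu> A
  proof -
    have "upper_var \<nu> A \<le> 0"
      unfolding upper_var_def
    proof (rule SUP_least)
      fix B assume "B \<in> {B \<in> bdd_borel. B \<subseteq> A}"
      then have B: "B \<in> bdd_borel" "B \<subseteq> A"
        by auto
      have "measure (pos_var \<nu>) B \<le> measure (pos_var (\<lambda>A. - \<nu> A)) B"
        unfolding measure_def
        using B pos_var_finite[OF real_measure_uminus[OF \<nu>] B(1)]
        by (intro enn2real_mono le) (auto simp: bdd_borel_sets)
      then have "\<nu> B \<le> 0"
        using real_measure_eq_pos_var_diff[OF \<nu> B(1)] by simp
      then show "ennreal (\<nu> B) \<le> 0"
        by (simp add: ennreal_neg)
    qed
    then show ?thesis
      by (simp add: emeasure_pos_var \<nu> A bdd_borel_sets)
  qed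
  show ?thesis
  proof (rule that[OF D])
    show "emeasure (pos_var (\<lambda>A. - \<mu> A)) D = 0"
      using D le by (intro zero m) (auto intro: bdd_borel_subset[OF E])
    show "emeasure (pos_var \<mu>) (E - D) = 0"
      using D ge by (intro zero \<mu>) (auto intro: bdd_borel_Diff[OF E])
  qed
qed

lemma nn_integral_total_var_eq_pairing:
  fixes h :: "'a::euclidean_space \<Rightarrow> real"
  assumes \<mu>: "real_measure \<mu>" and [measurable]: "h \<in> borel_measurable borel" and D: "D \<in> bdd_borel"
    and h: "\<And>x. 0 \<le> h x" "\<And>x. h x \<le> c * indicator D x"
    and null: "emeasure (pos_var (\<lambda>A. - \<mu> A)) D = 0"
  shows "(\<integral>\<^sup>+x. ennreal (h x) \<partial>total_var \<mu>) = ennreal (pairing \<mu> h)"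
proof -
  note m = real_measure_uminus[OF \<mu>]
  note [measurable_cong] = sets_total_var[OF \<mu>] sets_pos_var[OF \<mu>] sets_pos_var[OF m]
  have [measurable]: "D \<in> sets borel"
    by (rule bdd_borel_sets[OF D])
  have eq: "density (total_var \<mu>) (indicator D) = density (pos_var \<mu>) (indicator D)"
  proof (rule measure_eqI)
    fix A assume "A \<in> sets (density (total_var \<mu>) (indicator D))"
    then have A: "A \<in> sets borel"
      by (simp add: \<mu>)
    have "emeasure (pos_var (\<lambda>A. - \<mu> A)) (D \<inter> A) \<le> emeasure (pos_var (\<lambda>A. - \<mu> A)) D"
      using A by (intro emeasure_mono) (auto simp: m)
    then have "emeasure (total_var \<mu>) (D \<inter> A) = emeasure (pos_var \<mu>) (D \<inter> A)"
      using A null by (simp add: emeasure_total_var[OF \<mu>])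
    then show "emeasure (density (total_var \<mu>) (indicator D)) A = emeasure (density (pos_var \<mu>) (indicator D)) A"
      using A by (subst (1 2) emeasure_restricted) (auto simp: \<mu>)
  qed (simp add: \<mu>)
  have hD: "indicator D x * ennreal (h x) = ennreal (h x)" for x
    using h[of x] by (cases "x \<in> D") auto
  have "(\<integral>\<^sup>+x. ennreal (h x) \<partial>total_var \<mu>) = (\<integral>\<^sup>+x. ennreal (h x) \<partial>density (total_var \<mu>) (indicator D))"
    by (subst nn_integral_density) (auto simp: hD)
  also have "\<dots> = (\<integral>\<^sup>+x. ennreal (h x) \<partial>pos_var \<mu>)"
    unfolding eq by (subst nn_integral_density) (auto simp: hD)
  also have "\<dots> = ennreal (\<integral>x. h x \<partial>pos_var \<mu>)"
    using h by (intro nn_integral_eq_integral integrable_pos_var[OF \<mu> _ D, where c = c]) auto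
  also have "(\<integral>x. h x \<partial>pos_var (\<lambda>A. - \<mu> A)) = 0"
  proof (rule integral_eq_zero_AE)
    have "D \<in> null_sets (pos_var (\<lambda>A. - \<mu> A))"
      using null by (simp add: null_sets_def m)
    then have "AE x in pos_var (\<lambda>A. - \<mu> A). x \<notin> D"
      by (rule AE_not_in)
    then show "AE x in pos_var (\<lambda>A. - \<mu> A). h x = 0"
    proof eventually_elim
      case (elim x)
      then show ?case
        using h[of x] by simp
    qed
  qed
  then have "(\<integral>x. h x \<partial>pos_var \<mu>) = pairing \<mu> h"
    by (simp add: pairing_def)
  finally show ?thesis .
qed

context second_order_rm
begin

text \<open>On a bounded set where \<open>1 / f\<close> is bounded, the Hahn decomposition turns the integral of
  \<open>1 / f\<close> against the total variation into a difference of two values of the set function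
  \<open>A \<mapsto> E(Z (M / f)(A))\<close>, which is controlled by the covariance measure of \<open>M / f\<close>.\<close>

lemma regulated_measure_ip:
  assumes [measurable]: "f \<in> borel_measurable borel" and f: "\<And>x. f x > 0"
    and Z: "square_integrable P Z"
    and N: "second_order_rm P (rm_divide P M f) C'"
    and fin: "emeasure (total_var C') UNIV < \<infinity>"
  shows "regulated_measure f (\<lambda>A. ip P Z (M A))"
proof -
  interpret N: second_order_rm P "rm_divide P M f" C'
    by (rule N)
  define \<mu> where "\<mu> = (\<lambda>A. ip P Z (M A))"
  have \<mu>: "real_measure \<mu>"
    unfolding \<mu>_def by (rule real_measure_ip[OF Z])
  note m = real_measure_uminus[OF \<mu>]
  note [measurable_cong] = sets_total_var[OF \<mu>]
  define c where "c = L2norm P Z * sqrt (measure (total_var C') UNIV)"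
  \<comment> \<open>For Borel \<open>A \<subseteq> E n\<close> the function
    \<open>indicator A x / f x\<close> is a test function, and every point lies in
    \<open>E n\<close> for all large \<open>n\<close>.\<close>
  define E where "E n = {x \<in> ball 0 (real n). 1 / f x \<le> real n}" for n
  have E_sets [measurable]: "E n \<in> sets borel" for n
    unfolding E_def by measurable
  have E_sub: "E n \<subseteq> ball 0 (real n)" for n
    by (auto simp: E_def)
  have E: "E n \<in> bdd_borel" for n
    by (rule bdd_borel_subset[OF bdd_borel_ball E_sets E_sub])
  have bound: "(\<integral>\<^sup>+x. ennreal (indicator (E n) x / f x) \<partial>total_var \<mu>) \<le> ennreal c" for n
  proof -
    obtain D where D: "D \<in> sets borel" "D \<subseteq> E n"
      "emeasure (pos_var (\<lambda>A. - \<mu> A)) D = 0" "emeasure (pos_var \<mu>) (E n - D) = 0"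
      by (rule real_measure_Hahn[OF \<mu> E])
    have [measurable]: "D \<in> sets borel"
      by (rule D)
    have DE: "D \<in> bdd_borel" "E n - D \<in> bdd_borel"
      using D by (auto intro: bdd_borel_subset[OF E] bdd_borel_Diff[OF E])
    have h: "indicator A x / f x \<le> real n * indicator A x" "0 \<le> indicator A x / f x"
      if "A \<subseteq> E n" for A x
      using that f[of x] by (auto simp: indicator_def E_def)
    have \<kappa>: "ip P Z (rm_divide P M f A) = pairing \<mu> (\<lambda>x. indicator A x / f x)"
      if A: "A \<subseteq> E n" "A \<in> bdd_borel" for A
      unfolding rm_divide_def \<mu>_def
    proof (rule ip_rm_integral[OF Z test_functionI[OF _ A(2), where b = "real n"]])
      have [measurable]: "A \<in> sets borel"
        by (rule bdd_borel_sets[OF A(2)])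
      show "(\<lambda>x. indicator A x / f x) \<in> borel_measurable borel"
        by measurable
      show "\<bar>indicator A x / f x\<bar> \<le> real n * indicator A x" for x
        using h[OF A(1), of x] by simp
    qed
    have pos: "(\<integral>\<^sup>+x. ennreal (indicator D x / f x) \<partial>total_var \<mu>) = ennreal (ip P Z (rm_divide P M f D))"
      unfolding \<kappa>[OF D(2) DE(1)]
      by (rule nn_integral_total_var_eq_pairing[OF \<mu> _ DE(1) h(2)[OF D(2)] h(1)[OF D(2)] D(3)]) measurable
    \<comment> \<open>On the other half the Jordan parts exchange roles, so the identity is applied
      to \<open>- \<mu>\<close>, which has the same total variation.\<close>
    have "(\<integral>\<^sup>+x. ennreal (indicator (E n - D) x / f x) \<partial>total_var (\<lambda>A. - \<mu> A))
        = ennreal (pairing (\<lambda>A. - \<mu> A) (\<lambda>x. indicator (E n - D) x / f x))"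
      by (rule nn_integral_total_var_eq_pairing[OF m _ DE(2) h(2) h(1)]) (use D(4) in auto)
    then have neg: "(\<integral>\<^sup>+x. ennreal (indicator (E n - D) x / f x) \<partial>total_var \<mu>)
        = ennreal (- ip P Z (rm_divide P M f (E n - D)))"
      by (simp add: total_var_uminus pairing_uminus \<kappa> DE)
    \<comment> \<open>\<open>ennreal\<close> truncates, so the signs must be known before the two
      values merge into one difference.\<close>
    have sign: "0 \<le> ip P Z (rm_divide P M f D)" "ip P Z (rm_divide P M f (E n - D)) \<le> 0"
    proof -
      have zero: "(\<integral>x. indicator A x / f x \<partial>pos_var \<nu>) = 0"
        if \<nu>: "real_measure \<nu>" and A: "A \<in> sets borel" "emeasure (pos_var \<nu>) A = 0" for \<nu> A
      proof (rule integral_eq_zero_AE)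
        have "A \<in> null_sets (pos_var \<nu>)"
          using A by (simp add: null_sets_def \<nu>)
        then have "AE x in pos_var \<nu>. x \<notin> A"
          by (rule AE_not_in)
        then show "AE x in pos_var \<nu>. indicator A x / f x = 0"
          by eventually_elim simp
      qed
      show "0 \<le> ip P Z (rm_divide P M f D)"
        unfolding \<kappa>[OF D(2) DE(1)] pairing_def zero[OF m D(1,3)]
        by (simp add: integral_nonneg_AE h D(2))
      show "ip P Z (rm_divide P M f (E n - D)) \<le> 0"
        unfolding \<kappa>[OF Diff_subset DE(2)] pairing_def zero[OF \<mu> bdd_borel_sets[OF DE(2)] D(4)]
        by (simp add: integral_nonneg_AE h)
    qed
    have "(\<integral>\<^sup>+x. ennreal (indicator (E n) x / f x) \<partial>total_var \<mu>)
        = (\<integral>\<^sup>+x. ennreal (indicator D x / f x) + ennreal (indicator (E n - D) x / f x) \<partial>total_var \<mu>)"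
      using D(2) by (intro nn_integral_cong) (auto simp: indicator_def)
    also have "\<dots> = ennreal (ip P Z (rm_divide P M f D)) + ennreal (- ip P Z (rm_divide P M f (E n - D)))"
      unfolding pos[symmetric] neg[symmetric] by (rule nn_integral_add) measurable
    also have "\<dots> = ennreal (ip P Z (rm_divide P M f D) - ip P Z (rm_divide P M f (E n - D)))"
      using sign by (simp add: ennreal_plus[symmetric] del: ennreal_plus)
    also have "\<dots> \<le> ennreal c"
    proof (rule ennreal_leI)
      have "ip P Z (rm_divide P M f D) - ip P Z (rm_divide P M f (E n - D))
          \<le> L2norm P Z * sqrt (measure (total_var C') (E n \<times> E n))"
        using D(2) by (intro N.ip_measure_diff_le Z DE E) auto
      also have "\<dots> \<le> c"
        unfolding c_def measure_def using fin
        by (intro mult_left_mono real_sqrt_le_mono enn2real_mono emeasure_mono)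
          (auto simp: N.real_measure_C)
      finally show "ip P Z (rm_divide P M f D) - ip P Z (rm_divide P M f (E n - D)) \<le> c" .
    qed
    finally show ?thesis .
  qed
  \<comment> \<open>Since \<open>c\<close> does not depend on \<open>n\<close>, Fatou's lemma
    removes the truncation.\<close>
  have "(\<integral>\<^sup>+x. ennreal (1 / f x) \<partial>total_var \<mu>)
      = (\<integral>\<^sup>+x. liminf (\<lambda>n. ennreal (indicator (E n) x / f x)) \<partial>total_var \<mu>)"
  proof (rule nn_integral_cong)
    fix x
    obtain n0 :: nat where n0: "max (norm x) (1 / f x) < real n0"
      using reals_Archimedean2 by blast
    have "\<forall>\<^sub>F n in sequentially. ennreal (indicator (E n) x / f x) = ennreal (1 / f x)"
      using eventually_ge_at_top[of n0]
    proof eventually_elim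
      case (elim n)
      then have "x \<in> E n"
        using n0 unfolding E_def by (auto simp: dist_norm)
      then show ?case
        by simp
    qed
    then show "ennreal (1 / f x) = liminf (\<lambda>n. ennreal (indicator (E n) x / f x))"
      by (intro lim_imp_Liminf[symmetric] tendsto_eventually) auto
  qed
  also have "\<dots> \<le> liminf (\<lambda>n. \<integral>\<^sup>+x. ennreal (indicator (E n) x / f x) \<partial>total_var \<mu>)"
    by (rule nn_integral_liminf) measurable
  also have "\<dots> \<le> liminf (\<lambda>n::nat. ennreal c)"
    by (intro Liminf_mono always_eventually allI bound)
  also have "\<dots> < \<infinity>"
    by (simp add: Liminf_const)
  finally show ?thesis
    by (simp add: regulated_measure_def \<mu>_def)
qed

end

section \<open>The expansion\<close>

theorem theorem3p2:
  fixes P :: "'w measure"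
    and M :: "'a::euclidean_space set \<Rightarrow> 'w \<Rightarrow> real"
    and f :: "'a \<Rightarrow> real"
  assumes "prob_space P"
    and "f \<in> borel_measurable borel" and "\<And>x. f x > 0" and "locally_bounded f"
    and "mcov_random_measure P M"
    and "regulated_random_measure P f M"
  shows "\<exists>(X :: nat \<Rightarrow> 'w \<Rightarrow> real) (\<mu> :: nat \<Rightarrow> 'a set \<Rightarrow> real).
      (\<forall>n. square_integrable P (X n)) \<and>
      (\<forall>i j. i \<noteq> j \<longrightarrow> covariance P (X i) (X j) = 0) \<and>
      summable (\<lambda>n. prob_space.variance P (X n)) \<and>
      (\<forall>n. real_measure (\<mu> n) \<and> regulated_measure f (\<mu> n)) \<and>
      lin_indep_measures \<mu> \<and>
      (\<forall>\<phi>. test_function \<phi> \<longrightarrow>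
         L2_tendsto P (\<lambda>n \<omega>. \<Sum>j<n. X j \<omega> * pairing (\<mu> j) \<phi>) (rm_integral P M \<phi>)) \<and>
      (\<forall>\<phi> K. test_function \<phi> \<longrightarrow> compact K \<longrightarrow>
         (\<lambda>n. emeasure (total_var (\<lambda>B.
             pairing (cov_measure P M) (tensor \<phi> (indicator B))
             - (\<Sum>j\<le>n. prob_space.variance P (X j) * pairing (\<mu> j) \<phi> * \<mu> j B))) K)
         \<longlonglongrightarrow> 0)"
proof -
  have second_order: "second_order_rm P N (cov_measure P N)"
    if "mcov_random_measure P N" for N :: "'a set \<Rightarrow> 'w \<Rightarrow> real"
  proof -
    have "is_cov_measure P N (cov_measure P N)"
      using that someI_ex[of "is_cov_measure P N"]
      by (simp add: mcov_random_measure_def cov_measure_def)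
    then show ?thesis
      using that \<open>prob_space P\<close>
      by (simp add: second_order_rm_def second_order_rm_axioms_def mcov_random_measure_def
          is_cov_measure_def ip_def)
  qed
  interpret second_order_rm P M "cov_measure P M"
    by (rule second_order[OF assms(5)])
  obtain g :: "nat \<Rightarrow> 'a set" where g: "\<And>k. g k \<in> bdd_borel"
    and total: "\<And>e A. orthonormal P e \<Longrightarrow> (\<And>k. orthonormal.spanned P e (M (g k))) \<Longrightarrow>
      A \<in> bdd_borel \<Longrightarrow> orthonormal.spanned P e (M A)"
    using total_sequence by blast
  define e where "e = gram_schmidt P (\<lambda>k. M (g k))"
  have Mg: "square_integrable P (M (g k))" for k
    by (rule sq_M[OF g])
  interpret orthonormal P e
    unfolding e_def by (rule orthonormal_gram_schmidt[OF Mg])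
  have spanned_M: "spanned (M A)" if "A \<in> bdd_borel" for A
    unfolding e_def
    by (rule total[OF orthonormal_gram_schmidt[OF Mg] spanned_gram_schmidt[OF Mg] that])
  have e_span: "\<exists>c. e k = (\<lambda>\<omega>. \<Sum>j\<le>k. c j * M (g j) \<omega>)" for k
    unfolding e_def by (rule gram_schmidt_in_span[OF Mg])
  \<comment> \<open>Finite combinations of centred variables are centred, so covariances and
    variances below are plain inner products.\<close>
  have mean: "(\<integral>\<omega>. e k \<omega> \<partial>P) = 0" for k
  proof -
    have "integrable P (M (g j))" for j
      using square_integrable_mult[OF Mg, of "\<lambda>_. 1"] by (simp add: square_integrable_def)
    moreover have "(\<integral>\<omega>. M (g j) \<omega> \<partial>P) = 0" for j
      using assms(5) g by (simp add: mcov_random_measure_def)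
    moreover obtain c where "e k = (\<lambda>\<omega>. \<Sum>j\<le>k. c j * M (g j) \<omega>)"
      using e_span by blast
    ultimately show ?thesis
      by (simp add: Bochner_Integration.integral_sum)
  qed

  \<comment> \<open>Where the covariance measure has no atom on the diagonal, \<open>M {x}\<close>
    has norm 0. One countable exceptional set thus serves all measures at once, and infinitely many
    points of the ball remain.\<close>
  define S where "S = ball (0::'a) 1 - {x. cov_measure P M {(x, x)} \<noteq> 0}"
  have "countable {x. cov_measure P M {(x, x)} \<noteq> 0}"
  proof (rule countable_image_inj_on)
    show "countable ((\<lambda>x. (x, x)) ` {x. cov_measure P M {(x, x)} \<noteq> 0})"
      by (rule countable_subset[OF _ countable_atoms[OF real_measure_C]]) auto
  qed (auto simp: inj_on_def)
  then have "infinite S"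
    using uncountable_ball[of 1 "0::'a"] unfolding S_def
    by (meson countable_finite uncountable_minus_countable zero_less_one)
  then obtain p :: "nat \<Rightarrow> 'a" where p: "inj p" "range p \<subseteq> S"
    using infinite_countable_subset by blast
  have p_bdd: "{p k} \<in> bdd_borel" for k
    by (simp add: bdd_borel_def)
  have no_atom: "ip P Z (M {p k}) = 0" if "square_integrable P Z" for Z k
  proof -
    have "L2norm P (M {p k}) = 0"
      using p(2) cov[OF p_bdd p_bdd, of k k] by (auto simp: S_def L2norm_def)
    then show ?thesis
      using ip_Cauchy_Schwarz[OF that sq_M[OF p_bdd]] by (metis abs_le_zero_iff mult_zero_right)
  qed

  define X where "X n = (\<lambda>\<omega>. (1/2) ^ n * e n \<omega>)" for n
  define d where "d n = (\<lambda>\<omega>. 2 ^ n * e n \<omega>)" for n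
  define \<mu> where "\<mu> n = (if e n = (\<lambda>_. 0) then (\<lambda>A. indicator A (p n)) else (\<lambda>A. ip P (d n) (M A)))" for n
  have sq_X: "square_integrable P (X n)" and sq_d: "square_integrable P (d n)" for n
    unfolding X_def d_def by (intro square_integrable_cmult sq_e)+
  have mean_X: "(\<integral>\<omega>. X n \<omega> \<partial>P) = 0" for n
    by (simp add: X_def mean)
  have var: "prob_space.variance P (X n) = (1/2) ^ n * (1/2) ^ n * ip P (e n) (e n)" for n
  proof -
    have "prob_space.variance P (X n) = ip P (X n) (X n)"
      by (simp add: mean_X ip_def power2_eq_square)
    then show ?thesis
      unfolding X_def ip_cmult_left ip_cmult_right by (simp add: mult.assoc)
  qed
  \<comment> \<open>The powers of 2 cancel. If \<open>e j\<close> vanishes, both sides are 0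
    whatever the Dirac measure contributes.\<close>
  have coeff: "X j \<omega> * pairing (\<mu> j) \<phi> = ip P (rm_integral P M \<phi>) (e j) * e j \<omega>"
    if \<phi>: "test_function \<phi>" for \<phi> j \<omega>
  proof (cases "e j = (\<lambda>_. 0)")
    case False
    then have "pairing (\<mu> j) \<phi> = ip P (d j) (rm_integral P M \<phi>)"
      using ip_rm_integral[OF sq_d \<phi>] by (simp add: \<mu>_def)
    also have "\<dots> = 2 ^ j * ip P (rm_integral P M \<phi>) (e j)"
      unfolding d_def ip_cmult_left by (simp add: ip_commute)
    finally show ?thesis
      by (simp add: X_def power_one_over)
  qed (simp add: X_def)
  \<comment> \<open>The variance contributes \<open>(1/2) ^ j\<close> twice, and each of the two
    factors from \<open>\<mu> j\<close> contributes \<open>2 ^ j\<close>.\<close>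
  have var_coeff: "prob_space.variance P (X j) * pairing (\<mu> j) \<phi> * \<mu> j B
      = ip P (rm_integral P M \<phi>) (e j) * ip P (e j) (M B)"
    if \<phi>: "test_function \<phi>" for \<phi> j B
  proof (cases "e j = (\<lambda>_. 0)")
    case False
    then have "pairing (\<mu> j) \<phi> = ip P (d j) (rm_integral P M \<phi>)"
      using ip_rm_integral[OF sq_d \<phi>] by (simp add: \<mu>_def)
    also have "\<dots> = 2 ^ j * ip P (rm_integral P M \<phi>) (e j)"
      unfolding d_def ip_cmult_left by (simp add: ip_commute)
    finally have "pairing (\<mu> j) \<phi> = 2 ^ j * ip P (rm_integral P M \<phi>) (e j)" .
    moreover have "\<mu> j B = 2 ^ j * ip P (e j) (M B)"
      using False unfolding \<mu>_def d_def by (simp add: ip_cmult_left)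
    moreover have "ip P (e j) (e j) = 1"
      using normal[of j] False by simp
    ultimately show ?thesis
      unfolding var by (simp add: power_one_over)
  qed (simp add: var)

  show ?thesis
  proof (rule exI[of _ X], rule exI[of _ \<mu>], intro conjI allI impI)
    show "square_integrable P (X n)" for n
      by (rule sq_X)
  next
    fix i j :: nat assume "i \<noteq> j"
    then have "ip P (X i) (X j) = 0"
      unfolding X_def ip_cmult_left ip_cmult_right by (simp add: ortho)
    then show "covariance P (X i) (X j) = 0"
      by (simp add: covariance_def mean_X ip_def)
  next
    show "summable (\<lambda>n. prob_space.variance P (X n))"
    proof (rule summable_comparison_test')
      show "summable (\<lambda>n. (1/2 :: real) ^ n)"
        by (rule summable_geometric) simp
      fix n :: nat
      have "ip P (e n) (e n) \<le> 1" "0 \<le> ip P (e n) (e n)"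
        using normal[of n] by auto
      moreover have "(1/2 :: real) ^ n \<le> 1"
        by (simp add: power_le_one)
      ultimately have "(1/2) ^ n * ((1/2) ^ n * ip P (e n) (e n)) \<le> (1/2) ^ n * (1 * 1)"
        by (intro mult_left_mono mult_mono) auto
      then show "norm (prob_space.variance P (X n)) \<le> (1/2) ^ n"
        unfolding var using \<open>0 \<le> ip P (e n) (e n)\<close> by (simp add: mult.assoc)
    qed
  next
    fix n
    show "real_measure (\<mu> n)"
      by (simp add: \<mu>_def real_measure_dirac real_measure_ip[OF sq_d])
    have "second_order_rm P (rm_divide P M f) (cov_measure P (rm_divide P M f))"
      "emeasure (total_var (cov_measure P (rm_divide P M f))) UNIV < \<infinity>"
      using assms(6) second_order
      by (auto simp: regulated_random_measure_def finite_random_measure_def finite_real_measure_def)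
    then show "regulated_measure f (\<mu> n)"
      unfolding \<mu>_def using regulated_measure_dirac[OF assms(2)] regulated_measure_ip[OF assms(2,3) sq_d]
      by simp
  next
    show "lin_indep_measures \<mu>"
      unfolding lin_indep_measures_def
    proof (intro allI impI)
      fix N i :: nat and c :: "nat \<Rightarrow> real"
      assume zero: "\<forall>A\<in>bdd_borel. (\<Sum>i<N. c i * \<mu> i A) = 0" and "i < N"
      \<comment> \<open>Evaluation at \<open>{p k}\<close> isolates one Dirac term: the other Dirac
        points differ by injectivity of \<open>p\<close>, and the inner-product measures have no
        atom there.\<close>
      have dirac: "c k = 0" if k: "k < N" "e k = (\<lambda>_. 0)" for k
      proof -
        have "(\<Sum>i<N. c i * \<mu> i {p k}) = (\<Sum>i<N. if i = k then c k else 0)"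
          using k no_atom[OF sq_d] p(1)
          by (intro sum.cong) (auto simp: \<mu>_def indicator_def dest: injD)
        then show ?thesis
          using zero p_bdd k by simp
      qed
      \<comment> \<open>With the Dirac coefficients gone, the relation says that \<open>Z\<close> is
        orthogonal to every \<open>M A\<close>, hence to \<open>e i\<close>, a finite combination of
        such variables. This forces \<open>c i * 2 ^ i = 0\<close>.\<close>
      define Z where "Z = (\<lambda>\<omega>. \<Sum>j<N. c j * d j \<omega>)"
      have sq_Z: "square_integrable P Z"
        unfolding Z_def by (intro square_integrable_sum square_integrable_cmult sq_d)
      have Z_M: "ip P Z (M A) = 0" if "A \<in> bdd_borel" for A
      proof -
        have "ip P Z (M A) = (\<Sum>j<N. c j * ip P (d j) (M A))"
          unfolding Z_def using that
          by (simp add: ip_sum_left square_integrable_cmult sq_d sq_M ip_cmult_left)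
        also have "\<dots> = (\<Sum>j<N. c j * \<mu> j A)"
          using dirac by (intro sum.cong) (auto simp: \<mu>_def)
        finally show ?thesis
          using zero that by simp
      qed
      show "c i = 0"
      proof (cases "e i = (\<lambda>_. 0)")
        case True
        then show ?thesis
          using dirac \<open>i < N\<close> by simp
      next
        case False
        obtain b where b: "e i = (\<lambda>\<omega>. \<Sum>j\<le>i. b j * M (g j) \<omega>)"
          using e_span[of i] by auto
        have "ip P Z (e i) = (\<Sum>j\<le>i. b j * ip P Z (M (g j)))"
          unfolding b by (simp add: ip_sum_right square_integrable_cmult Mg sq_Z ip_cmult_right)
        then have "ip P Z (e i) = 0"
          by (simp add: Z_M g)
        moreover have "ip P Z (e i) = (\<Sum>j<N. c j * 2 ^ j * ip P (e j) (e i))"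
          unfolding Z_def
          by (simp add: ip_sum_left square_integrable_cmult sq_d sq_e ip_cmult_left)
            (simp add: d_def ip_cmult_left mult.assoc)
        also have "\<dots> = (\<Sum>j<N. if j = i then c i * 2 ^ i else 0)"
          using normal[of i] False by (intro sum.cong) (auto simp: ortho)
        ultimately show ?thesis
          using \<open>i < N\<close> by simp
      qed
    qed
  next
    fix \<phi> :: "'a \<Rightarrow> real" assume \<phi>: "test_function \<phi>"
    let ?Y = "rm_integral P M \<phi>"
    have "spanned ?Y"
      by (rule spanned_rm_integral[OF orthonormal_axioms spanned_M \<phi>])
    then have lim: "(\<lambda>n. L2norm P (\<lambda>\<omega>. ?Y \<omega> - proj n ?Y \<omega>)) \<longlonglongrightarrow> 0"
      and sq_Y: "square_integrable P ?Y"
      by (auto simp: spanned_def)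
    have "(\<lambda>n \<omega>. \<Sum>j<n. X j \<omega> * pairing (\<mu> j) \<phi>) = (\<lambda>n. proj n ?Y)"
      by (simp add: coeff[OF \<phi>] proj_def)
    then show "L2_tendsto P (\<lambda>n \<omega>. \<Sum>j<n. X j \<omega> * pairing (\<mu> j) \<phi>) ?Y"
      using lim by (simp add: L2_tendsto_iff sq_Y L2norm_minus_commute[of P "proj _ ?Y" ?Y])
    fix K :: "'a set" assume "compact K"
    then have K: "K \<in> bdd_borel"
      by (simp add: bdd_borel_def compact_imp_bounded borel_compact)
    define R where "R n = (\<lambda>\<omega>. ?Y \<omega> - proj n ?Y \<omega>)" for n
    have sq_R: "square_integrable P (R n)" for n
      unfolding R_def by (intro square_integrable_diff sq_Y square_integrable_proj)
    \<comment> \<open>\<open>proj n\<close> runs over \<open>j < n\<close>, so the sum over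
      \<open>j \<le> n\<close> leaves the remainder of index \<open>Suc n\<close>.\<close>
    have eq: "total_var (\<lambda>B. pairing (cov_measure P M) (tensor \<phi> (indicator B))
             - (\<Sum>j\<le>n. prob_space.variance P (X j) * pairing (\<mu> j) \<phi> * \<mu> j B))
        = total_var (\<lambda>B. ip P (R (Suc n)) (M B))" for n
    proof (rule total_var_cong)
      fix B :: "'a set" assume B: "B \<in> bdd_borel"
      have "ip P (proj (Suc n) ?Y) (M B) = (\<Sum>j\<le>n. ip P ?Y (e j) * ip P (e j) (M B))"
        unfolding proj_def lessThan_Suc_atMost
        by (simp add: ip_sum_left square_integrable_cmult sq_e sq_M B ip_cmult_left)
      then show "pairing (cov_measure P M) (tensor \<phi> (indicator B))
             - (\<Sum>j\<le>n. prob_space.variance P (X j) * pairing (\<mu> j) \<phi> * \<mu> j B) = ip P (R (Suc n)) (M B)"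
        unfolding var_coeff[OF \<phi>] R_def
        by (simp add: ip_diff_left sq_Y sq_M B ip_rm_integral_measure[OF \<phi> B])
    qed
    let ?c = "sqrt (measure (total_var (cov_measure P M)) (K \<times> K))"
    have "(\<lambda>n. L2norm P (R (Suc n)) * ?c) \<longlonglongrightarrow> 0"
      using LIMSEQ_Suc[OF lim] unfolding R_def by (rule tendsto_mult_left_zero)
    then have "(\<lambda>n. ennreal (L2norm P (R (Suc n)) * ?c)) \<longlonglongrightarrow> ennreal 0"
      by (rule tendsto_ennrealI)
    then have "(\<lambda>n. ennreal (L2norm P (R (Suc n)) * ?c)) \<longlonglongrightarrow> 0"
      by simp
    then show "(\<lambda>n. emeasure (total_var (\<lambda>B. pairing (cov_measure P M) (tensor \<phi> (indicator B))
             - (\<Sum>j\<le>n. prob_space.variance P (X j) * pairing (\<mu> j) \<phi> * \<mu> j B))) K) \<longlonglongrightarrow> 0"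
      unfolding eq
      by (rule tendsto_sandwich[OF _ _ tendsto_const, rotated 2])
        (auto intro!: always_eventually total_var_ip_le sq_R K)
  qed
qed

end
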